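(* Let $(\mathbb U,\mathcal Q,\xi)$ be as in the context, let $J$ be a class of $(\mathbb U,\mathcal Q)$-distributors as in the context, and let $X$ be a $J$-cocomplete $(\mathbb U,\mathcal Q)$-category. The following are equivalent: (i) $X$ is $J$-continuous; (ii) the way-below $(\mathbb U,\mathcal Q)$-distributor $\Downarrow$ from $X$ to $X$ exists and is approximating; (iii) there exists a $J$-cocontinuous approximating $(\mathbb U,\mathcal Q)$-distributor $v$ from $X$ to $X$; (iv) there exists a $J$-cocontinuous $(\mathbb U,\mathcal Q)$-distributor $v$ from $X$ to $X$ which is approximating at $x$, for each $x\in X$.
   Context: Quantale. $\mathcal{Q}=(Q,\leqslant,\otimes,\mathbf{1})$ is a completely distributive complete lattice with a commutative monoid structure $(\otimes,\mathbf 1)$, $\otimes$ preserving arbitrary suprema in each variable, $\mathbf 1$ the greatest element, $\bot\neq\mathbf 1$; $Q(a,b)=\bigvee\{c\mid a\otimes c\leqslant b\}$. $\mathbb U=(U,e,m)$ is the ultrafilter monad on sets: $UX$ is the set of ultrafilters on $X$, $Uf(\sigma)=\{B\mid f^{-1}[B]\in\sigma\}$, $e_X(x)=\dot x$ the principal ultrafilter, $m_X(\Upsilon)=\{A\subseteq X\mid\{\sigma\in UX\mid A\in\sigma\}\in\Upsilon\}$. Let $\xi\colon UQ\to Q$, $\xi(\sigma)=\bigwedge_{A\in\sigma}\bigvee A$ (convergence of the Lawson topology). Standing assumptions: $\xi(U(\otimes)(\omega))=\xi(U\pi_1(\omega))\otimes\xi(U\pi_2(\omega))$ for $\omega\in U(Q\times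 Q)$ and $\xi(\dot{\mathbf 1})=\mathbf 1$; and whenever $f\colon X\to Y$, $\varphi\colon X\to Q$, $\psi\colon Y\to Q$ satisfy $\psi(y)\leqslant\bigvee_{f x=y}\varphi(x)$ for all $y$, then $\xi(U\psi(\sigma))\leqslant\bigvee_{Uf(\nu)=\sigma}\xi(U\varphi(\nu))$ for all $\sigma\in UY$. Relations. A $\mathcal Q$-relation from $X$ to $Y$ is a map $r\colon X\times Y\to Q$; $(s\cdot r)(x,z)=\bigvee_y r(x,y)\otimes s(y,z)$; $r^{op}$ is the transpose; functions are regarded as $\mathcal Q$-relations with values $\mathbf 1,\bot$; order is pointwise. $U$ is extended by $Ur(\sigma,\nu)=\bigwedge_{A\in\sigma,B\in\nu}\bigvee_{x\in A,y\in B}r(x,y)$. A $(\mathbb U,\mathcal Q)$-relation from $X$ to $Y$ is a $\mathcal Q$-relation $\alpha$ from $UX$ to $Y$; Kleisli convolution of $\alpha$ (from $X$ to $Y$) and $\beta$ (from $Y$ to $Z$) is $\beta\circ\alpha=\beta\cdot U\alpha\cdot m_X^{op}$. For $\alpha$ from $X$ to $Y$ and $\gamma$ from $X$ to $Z$, $\gamma\mathbin{\circ\!-}\alpha$ is the $(\mathbb U,\mathcal Q)$-relation from $Y$ to $Z$ given by $(\gamma\mathbin{\circ\!-}\alpha)(\upsilon,z)=\bigwedge_{\nu\in UX}Q((U\alpha\cdot m_X^{op})(\nu,\upsilon),\gamma(\nu,z))$. Categories. A $(\mathbb U,\mathcal Q)$-category is a set $X$ with a $(\mathbb U,\mathcal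 Q)$-relation $X(-,-)$ from $X$ to $X$ (also denoted $X$) with $\mathbf 1\leqslant X(\dot x,x)$ and $UX(\Upsilon,\upsilon)\otimes X(\upsilon,x)\leqslant X(m_X(\Upsilon),x)$. A $(\mathbb U,\mathcal Q)$-functor is a map $f\colon X\to Y$ with $X(\upsilon,x)\leqslant Y(Uf(\upsilon),f(x))$. Functors are ordered: $f\leqslant g$ iff $\mathbf 1\leqslant Y(e_Y(f x),g x)$ for all $x$; $f\cong g$ means both inequalities; adjunctions are taken in this ordered category, so $f\dashv g$ iff $Y(Uf(\sigma),y)=X(\sigma,g(y))$ for all $\sigma\in UX$, $y\in Y$. $Q$ is a $(\mathbb U,\mathcal Q)$-category via $(\sigma,v)\mapsto Q(\xi(\sigma),v)$. $|X|$ is the $(\mathbb U,\mathcal Q)$-category $UX$ with structure $m_X$. $1$ is the one-point category $(1,e_1^{op})$. Distributors. A $(\mathbb U,\mathcal Q)$-distributor from $X$ to $Y$ is a $(\mathbb U,\mathcal Q)$-relation $\varphi$ with $\varphi\circ X=\varphi$ and $Y\circ\varphi=\varphi$. A functor $f\colon X\to Y$ gives distributors $f_*(\sigma,y)=Y(Uf(\sigma),y)$ (from $X$ to $Y$) and $f^*(\nu,x)=Y(\nu,f(x))$ (from $Y$ to $X$); in particular for $x\in X$, viewed as $1\to X$, $x_*(\dot *,y)=X(\dot x,y)$ and $x^*=X(-,x)$. $\mathcal Q^{|X|}$ is the set of $(\mathbb U,\mathcal Q)$-functors $|X|\to Q$ with structure $\mathcal Q^{|X|}(\rho,\psi)=\bigwedge\{Q(\xi(U\mathrm{ev}(\varrho)),\psi(m_X(U\pi_1(\varrho))))\mid\varrho\in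 U(UX\times\mathcal Q^{|X|}),\,U\pi_2(\varrho)=\rho\}$, where $\mathrm{ev}(\nu,\psi)=\psi(\nu)$. $\widehat X\subseteq\mathcal Q^{|X|}$ is the full subcategory of those $\psi$ that are distributors from $X$ to $1$. Each distributor $\varphi$ from $X$ to $Y$ yields a functor $\ulcorner\varphi\urcorner\colon Y\to\widehat X$, $y\mapsto\varphi(-,y)$; the Yoneda functor is $\mathsf y=\ulcorner X\urcorner\colon X\to\widehat X$, $x\mapsto X(-,x)$. The class $J$. $J$ is a class of $(\mathbb U,\mathcal Q)$-distributors closed under Kleisli convolution, containing $f^*$ for every functor $f$, and such that a distributor $\varphi$ from $X$ to $Y$ is in $J$ whenever $y^*\circ\varphi\in J$ for all $y\in Y$ (note $y^*\circ\varphi=\varphi(-,y)$). $JX$ is the full subcategory of $\widehat X$ on the distributors from $X$ to $1$ in $J$; $\mathsf y$ corestricts to $\mathsf y\colon X\to JX$, and $\mathsf y_*(\nu,\psi)=\psi(\nu)$. $X$ is $J$-cocomplete if $\mathsf y\colon X\to JX$ has a left adjoint $\mathcal S\colon JX\to X$, i.e. a functor with $X(U\mathcal S(\Upsilon),x)=\widehat X(\Upsilon,\mathsf y(x))$ for all $\Upsilon\in U(JX)$, $x\in X$. Continuity. A $J$-cocomplete $X$ is $J$-continuous if $\mathcal S\colon JX\to X$ has a left adjoint $(\mathbb U,\mathcal Q)$-functor. The way-below distributor $\Downarrow$ from $X$ to $X$, if it exists, is the lifting of $\mathsf y_*$ along $\mathcal S^*$: a distributor such that for every distributor $\gamma$ from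 $X$ to $X$, $\mathcal S^*\circ\gamma\leqslant\mathsf y_*$ iff $\gamma\leqslant\Downarrow$. A distributor $v$ from $X$ to $X$ is approximating if $v\in J$ and $X\mathbin{\circ\!-}v=X$; it is approximating at $x\in X$ if $v\in J$ and $X\mathbin{\circ\!-}v_x=x_*$, where $v_x=x^*\circ v$; it is $J$-cocontinuous if $\mathcal S^*\circ v=\mathsf y_*\circ v$. *)

theory Defs
  imports Complex_Main "HOL-Library.FuncSet"
begin

text \<open>
  Conventions. Sets are subsets of types; a map with a set as its domain is an extensional
  function (\<^const>\<open>undefined\<close> outside its domain), so that equality of relations and
  of elements of presheaf categories is equality on the domain. The value set \<open>Q\<close> of the
  quantale is a type; its tensor is \<open>*\<close> and its unit is \<open>1\<close>.
  An ultrafilter on \<open>X\<close> is represented by the ultrafilter of type \<^typ>\<open>'a filter\<close>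
  that it generates on the ambient type; hence \<open>Uf\<close> is \<^const>\<open>filtermap\<close>, \<open>e\<close> sends
  \<open>x\<close> to \<open>principal {x}\<close>, and \<open>U\<close> of a subset inclusion is the identity.
\<close>

section \<open>Quantale and ultrafilter monad\<close>

class quantale = complete_distrib_lattice + comm_monoid_mult +
  assumes mult_Sup_distrib: "a * Sup B = (SUP b\<in>B. a * b)"
    and one_eq_top: "1 = top"
    and bot_neq_one: "bot \<noteq> 1"

definition qhom :: "'q::quantale \<Rightarrow> 'q \<Rightarrow> 'q" where
  "qhom a b = Sup {c. a * c \<le> b}"

definition is_ultrafilter :: "'a filter \<Rightarrow> bool" where
  "is_ultrafilter F \<longleftrightarrow> F \<noteq> bot \<and> (\<forall>P. eventually P F \<or> eventually (\<lambda>x. \<not> P x) F)"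

definition UF :: "'a set \<Rightarrow> 'a filter set" where
  "UF X = {F. is_ultrafilter F \<and> eventually (\<lambda>x. x \<in> X) F}"

abbreviation pt :: "'a \<Rightarrow> 'a filter" where
  "pt x \<equiv> principal {x}"

definition umult :: "'a filter filter \<Rightarrow> 'a filter" where
  "umult F = Abs_filter (\<lambda>P. eventually (\<lambda>\<sigma>. eventually P \<sigma>) F)"

lemma eventually_umult:
  "eventually P (umult F) \<longleftrightarrow> eventually (\<lambda>\<sigma>. eventually P \<sigma>) F"
  unfolding umult_def
proof (rule eventually_Abs_filter, rule is_filter.intro)
  show "eventually (\<lambda>\<sigma>. eventually (\<lambda>x. True) \<sigma>) F"
    by simp
  show "eventually (\<lambda>\<sigma>. eventually (\<lambda>x. P x \<and> Q x) \<sigma>) F"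
    if "eventually (\<lambda>\<sigma>. eventually P \<sigma>) F" "eventually (\<lambda>\<sigma>. eventually Q \<sigma>) F" for P Q
    using that by (simp add: eventually_conj_iff)
  show "eventually (\<lambda>\<sigma>. eventually Q \<sigma>) F"
    if "\<forall>x. P x \<longrightarrow> Q x" "eventually (\<lambda>\<sigma>. eventually P \<sigma>) F" for P Q
    using that(2) by (rule eventually_mono) (use that(1) in \<open>blast intro: eventually_mono\<close>)
qed

definition xi :: "'q::complete_lattice filter \<Rightarrow> 'q" where
  "xi \<sigma> = Inf (Sup ` {A. eventually (\<lambda>v. v \<in> A) \<sigma>})"

text \<open>
  The standing assumptions on \<open>\<xi>\<close>. The last one ranges over all sets \<open>X\<close>, \<open>Y\<close>,
  which is rendered by all subsets of an arbitrary type. Nothing is lost: the lemma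
  \<open>xi_lax_sup\<close> proves it for arbitrary types.
\<close>

definition strict_topological_theory :: "'q::quantale itself \<Rightarrow> 'u itself \<Rightarrow> bool" where
  "strict_topological_theory _ _ \<longleftrightarrow>
     (\<forall>\<omega> \<in> UF (UNIV :: ('q \<times> 'q) set).
        xi (filtermap (\<lambda>(a, b). a * b) \<omega>) = xi (filtermap fst \<omega>) * xi (filtermap snd \<omega>)) \<and>
     xi (pt (1 :: 'q)) = 1 \<and>
     (\<forall>(X :: 'u set) (Y :: 'u set) f (\<phi> :: 'u \<Rightarrow> 'q) (\<psi> :: 'u \<Rightarrow> 'q).
        f \<in> X \<rightarrow> Y \<longrightarrow> (\<forall>y\<in>Y. \<psi> y \<le> (SUP x\<in>{x\<in>X. f x = y}. \<phi> x)) \<longrightarrow>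
        (\<forall>\<sigma>\<in>UF Y. xi (filtermap \<psi> \<sigma>)
            \<le> (SUP \<nu>\<in>{\<nu>\<in>UF X. filtermap f \<nu> = \<sigma>}. xi (filtermap \<phi> \<nu>))))"

lemma UF_filtermap:
  assumes "f \<in> X \<rightarrow> Y" "\<sigma> \<in> UF X"
  shows "filtermap f \<sigma> \<in> UF Y"
  using assms unfolding UF_def is_ultrafilter_def
  by (auto simp: eventually_filtermap filtermap_bot_iff elim: eventually_mono)

lemma UF_pt: "x \<in> X \<Longrightarrow> pt x \<in> UF X"
  unfolding UF_def is_ultrafilter_def by (auto simp: eventually_principal principal_eq_bot_iff)

lemma xi_lax_sup:
  fixes \<phi> :: "'a \<Rightarrow> 'q::complete_distrib_lattice" and \<psi> :: "'b \<Rightarrow> 'q"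
  assumes f: "f \<in> X \<rightarrow> Y"
    and le: "\<And>y. y \<in> Y \<Longrightarrow> \<psi> y \<le> (SUP x\<in>{x\<in>X. f x = y}. \<phi> x)"
    and \<sigma>: "\<sigma> \<in> UF Y"
  shows "xi (filtermap \<psi> \<sigma>) \<le> (SUP \<nu>\<in>{\<nu>\<in>UF X. filtermap f \<nu> = \<sigma>}. xi (filtermap \<phi> \<nu>))"
    (is "_ \<le> ?R")
proof -
  have ult: "eventually P \<sigma> \<or> eventually (\<lambda>x. \<not> P x) \<sigma>" and nb: "\<sigma> \<noteq> bot"
    and evY: "eventually (\<lambda>y. y \<in> Y) \<sigma>" for P
    using \<sigma> by (auto simp: UF_def is_ultrafilter_def)
  define F where "F = {A. A \<subseteq> Y \<and> eventually (\<lambda>y. y \<in> A) \<sigma>}"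
  define D where "D = (\<lambda>A. {x \<in> X. f x \<in> A}) ` F"
  have "xi (filtermap \<psi> \<sigma>) \<le> (INF E\<in>D. Sup (\<phi> ` E))"
  proof (rule INF_greatest)
    fix E assume "E \<in> D"
    then obtain A where A: "A \<subseteq> Y" "eventually (\<lambda>y. y \<in> A) \<sigma>" and E: "E = {x \<in> X. f x \<in> A}"
      by (auto simp: D_def F_def)
    have "eventually (\<lambda>v. v \<in> \<psi> ` A) (filtermap \<psi> \<sigma>)"
      using A(2) by (auto simp: eventually_filtermap elim: eventually_mono)
    then have "xi (filtermap \<psi> \<sigma>) \<le> Sup (\<psi> ` A)"
      unfolding xi_def by (intro INF_lower) auto
    also have "\<dots> \<le> Sup (\<phi> ` E)"
    proof (rule SUP_least)
      fix y assume y: "y \<in> A"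
      then have "\<psi> y \<le> (SUP x\<in>{x\<in>X. f x = y}. \<phi> x)" using le A(1) by blast
      also have "\<dots> \<le> Sup (\<phi> ` E)" using y E by (intro SUP_subset_mono) auto
      finally show "\<psi> y \<le> Sup (\<phi> ` E)" .
    qed
    finally show "xi (filtermap \<psi> \<sigma>) \<le> Sup (\<phi> ` E)" .
  qed
  also have "\<dots> = (SUP C\<in>{c ` D |c. \<forall>E\<in>D. c E \<in> E}. Inf (\<phi> ` C))"
    by (rule INF_SUP_set)
  also have "\<dots> \<le> ?R"
  proof (rule SUP_least)
    fix C assume "C \<in> {c ` D |c. \<forall>E\<in>D. c E \<in> E}"
    then obtain c where C: "C = c ` D" and c: "\<And>E. E \<in> D \<Longrightarrow> c E \<in> E" by blast
    define u where "u = Inf (\<phi> ` C)"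
    define T where "T = f ` {x \<in> X. u \<le> \<phi> x}"
    define g where "g = inv_into {x \<in> X. u \<le> \<phi> x} f"
    have T: "eventually (\<lambda>y. y \<in> T) \<sigma>"
    proof (rule ccontr)
      assume "\<not> eventually (\<lambda>y. y \<in> T) \<sigma>"
      then have "eventually (\<lambda>y. y \<in> Y - T) \<sigma>"
        using ult[of "\<lambda>y. y \<in> T"] evY by (auto simp: eventually_conj_iff)
      then have "Y - T \<in> F" by (auto simp: F_def)
      then have D: "{x \<in> X. f x \<in> Y - T} \<in> D" unfolding D_def by (rule imageI)
      then have "u \<le> \<phi> (c {x \<in> X. f x \<in> Y - T})"
        unfolding u_def C by (intro INF_lower imageI)
      with c[OF D] show False by (auto simp: T_def)
    qed
    have g: "g y \<in> X" "u \<le> \<phi> (g y)" "f (g y) = y" if "y \<in> T" for y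
      using that inv_into_into[of y f "{x \<in> X. u \<le> \<phi> x}"] f_inv_into_f[of y f "{x \<in> X. u \<le> \<phi> x}"]
      by (auto simp: T_def g_def)
    define \<nu> where "\<nu> = filtermap g \<sigma>"
    have "\<sigma> \<in> UF T" using \<sigma> T by (simp add: UF_def)
    then have \<nu>: "\<nu> \<in> UF X" unfolding \<nu>_def using g(1) by (intro UF_filtermap) auto
    have f\<nu>: "filtermap f \<nu> = \<sigma>"
    proof (rule filter_eq_iff[THEN iffD2], intro allI)
      fix P
      have "eventually (\<lambda>y. P (f (g y)) \<longleftrightarrow> P y) \<sigma>" using T by (rule eventually_mono) (simp add: g)
      then show "eventually P (filtermap f \<nu>) = eventually P \<sigma>"
        by (simp add: \<nu>_def eventually_filtermap eventually_subst)
    qed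
    have "u \<le> xi (filtermap \<phi> \<nu>)"
      unfolding xi_def
    proof (rule INF_greatest)
      fix A assume "A \<in> {A. eventually (\<lambda>v. v \<in> A) (filtermap \<phi> \<nu>)}"
      then have "eventually (\<lambda>y. \<phi> (g y) \<in> A) \<sigma>" by (simp add: \<nu>_def eventually_filtermap)
      with T have "eventually (\<lambda>y. \<phi> (g y) \<in> A \<and> u \<le> \<phi> (g y)) \<sigma>"
        by eventually_elim (simp add: g)
      then obtain y where "\<phi> (g y) \<in> A" "u \<le> \<phi> (g y)" using nb eventually_happens' by blast
      then show "u \<le> Sup A" by (meson Sup_upper order_trans)
    qed
    also have "\<dots> \<le> ?R" using \<nu> f\<nu> by (intro SUP_upper) auto
    finally show "Inf (\<phi> ` C) \<le> ?R" unfolding u_def .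
  qed
  finally show ?thesis .
qed

section \<open>Relations\<close>

definition rel :: "'a set \<Rightarrow> 'b set \<Rightarrow> ('a \<times> 'b \<Rightarrow> 'q) set" where
  "rel X Y = X \<times> Y \<rightarrow>\<^sub>E UNIV"

definition rel_le :: "'a set \<Rightarrow> 'b set \<Rightarrow> ('a \<times> 'b \<Rightarrow> 'q::order) \<Rightarrow> ('a \<times> 'b \<Rightarrow> 'q) \<Rightarrow> bool" where
  "rel_le X Y r s \<longleftrightarrow> (\<forall>x\<in>X. \<forall>y\<in>Y. r (x, y) \<le> s (x, y))"

text \<open>\<open>rcomp X Y Z s r\<close> is \<open>s \<cdot> r\<close> for \<open>r\<close> from \<open>X\<close> to \<open>Y\<close> and \<open>s\<close> from \<open>Y\<close> to \<open>Z\<close>.\<close>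

definition rcomp :: "'a set \<Rightarrow> 'b set \<Rightarrow> 'c set \<Rightarrow> ('b \<times> 'c \<Rightarrow> 'q::quantale) \<Rightarrow>
    ('a \<times> 'b \<Rightarrow> 'q) \<Rightarrow> 'a \<times> 'c \<Rightarrow> 'q" where
  "rcomp X Y Z s r = (\<lambda>(x, z)\<in>X \<times> Z. SUP y\<in>Y. r (x, y) * s (y, z))"

definition converse_rel :: "'a set \<Rightarrow> 'b set \<Rightarrow> ('a \<times> 'b \<Rightarrow> 'q) \<Rightarrow> 'b \<times> 'a \<Rightarrow> 'q" where
  "converse_rel X Y r = (\<lambda>(y, x)\<in>Y \<times> X. r (x, y))"

definition graph_rel :: "'a set \<Rightarrow> 'b set \<Rightarrow> ('a \<Rightarrow> 'b) \<Rightarrow> 'a \<times> 'b \<Rightarrow> 'q::quantale" where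
  "graph_rel X Y f = (\<lambda>(x, y)\<in>X \<times> Y. if f x = y then 1 else bot)"

definition Urel :: "'a set \<Rightarrow> 'b set \<Rightarrow> ('a \<times> 'b \<Rightarrow> 'q::quantale) \<Rightarrow>
    'a filter \<times> 'b filter \<Rightarrow> 'q" where
  "Urel X Y r = (\<lambda>(\<sigma>, \<nu>)\<in>UF X \<times> UF Y.
     INF (A, B)\<in>{A. A \<subseteq> X \<and> eventually (\<lambda>x. x \<in> A) \<sigma>} \<times> {B. B \<subseteq> Y \<and> eventually (\<lambda>y. y \<in> B) \<nu>}.
       SUP (x, y)\<in>A \<times> B. r (x, y))"

text \<open>
  A \<open>(\<bbbU>,\<Q>)\<close>-relation from \<open>X\<close> to \<open>Y\<close> is an element of \<^term>\<open>rel (UF X) Y\<close>.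
  \<open>Ulift X Y \<alpha>\<close> is \<open>U\<alpha> \<cdot> m\<^sub>X\<^sup>o\<^sup>p\<close>, and
  \<open>kconv X Y Z \<beta> \<alpha>\<close> is the Kleisli convolution \<open>\<beta> \<circ> \<alpha>\<close> for \<open>\<alpha>\<close> from \<open>X\<close> to \<open>Y\<close> and
  \<open>\<beta>\<close> from \<open>Y\<close> to \<open>Z\<close>.
\<close>

definition Ulift :: "'a set \<Rightarrow> 'b set \<Rightarrow> ('a filter \<times> 'b \<Rightarrow> 'q::quantale) \<Rightarrow>
    'a filter \<times> 'b filter \<Rightarrow> 'q" where
  "Ulift X Y \<alpha> = rcomp (UF X) (UF (UF X)) (UF Y)
     (Urel (UF X) Y \<alpha>) (converse_rel (UF (UF X)) (UF X) (graph_rel (UF (UF X)) (UF X) umult))"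

definition kconv :: "'a set \<Rightarrow> 'b set \<Rightarrow> 'c set \<Rightarrow> ('b filter \<times> 'c \<Rightarrow> 'q::quantale) \<Rightarrow>
    ('a filter \<times> 'b \<Rightarrow> 'q) \<Rightarrow> 'a filter \<times> 'c \<Rightarrow> 'q" where
  "kconv X Y Z \<beta> \<alpha> = rcomp (UF X) (UF Y) Z \<beta> (Ulift X Y \<alpha>)"

text \<open>\<open>kext X Y Z \<gamma> \<alpha>\<close> is the relation \<open>\<gamma> \<circ>- \<alpha>\<close> from \<open>Y\<close> to \<open>Z\<close>, for \<open>\<alpha>\<close> from \<open>X\<close> to \<open>Y\<close>
  and \<open>\<gamma>\<close> from \<open>X\<close> to \<open>Z\<close>.\<close>

definition kext :: "'a set \<Rightarrow> 'b set \<Rightarrow> 'c set \<Rightarrow> ('a filter \<times> 'c \<Rightarrow> 'q::quantale) \<Rightarrow>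
    ('a filter \<times> 'b \<Rightarrow> 'q) \<Rightarrow> 'b filter \<times> 'c \<Rightarrow> 'q" where
  "kext X Y Z \<gamma> \<alpha> = (\<lambda>(\<upsilon>, z)\<in>UF Y \<times> Z. INF \<nu>\<in>UF X. qhom (Ulift X Y \<alpha> (\<nu>, \<upsilon>)) (\<gamma> (\<nu>, z)))"

section \<open>Categories and functors\<close>

record ('a, 'q) ucat =
  obj :: "'a set"
  arr :: "'a filter \<times> 'a \<Rightarrow> 'q"

definition is_ucat :: "('a, 'q::quantale) ucat \<Rightarrow> bool" where
  "is_ucat X \<longleftrightarrow> arr X \<in> rel (UF (obj X)) (obj X) \<and>
     (\<forall>x\<in>obj X. 1 \<le> arr X (pt x, x)) \<and>
     (\<forall>\<Upsilon>\<in>UF (UF (obj X)). \<forall>\<upsilon>\<in>UF (obj X). \<forall>x\<in>obj X.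
        Urel (UF (obj X)) (obj X) (arr X) (\<Upsilon>, \<upsilon>) * arr X (\<upsilon>, x) \<le> arr X (umult \<Upsilon>, x))"

definition is_functor :: "('a, 'q::quantale) ucat \<Rightarrow> ('b, 'q) ucat \<Rightarrow> ('a \<Rightarrow> 'b) \<Rightarrow> bool" where
  "is_functor X Y f \<longleftrightarrow> f \<in> obj X \<rightarrow> obj Y \<and>
     (\<forall>\<upsilon>\<in>UF (obj X). \<forall>x\<in>obj X. arr X (\<upsilon>, x) \<le> arr Y (filtermap f \<upsilon>, f x))"

definition functor_le :: "('a, 'q::quantale) ucat \<Rightarrow> ('b, 'q) ucat \<Rightarrow>
    ('a \<Rightarrow> 'b) \<Rightarrow> ('a \<Rightarrow> 'b) \<Rightarrow> bool" where
  "functor_le X Y f g \<longleftrightarrow> (\<forall>x\<in>obj X. 1 \<le> arr Y (pt (f x), g x))"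

text \<open>\<open>f\<close> from \<open>X\<close> to \<open>Y\<close> is left adjoint to \<open>g\<close> in the ordered category of functors;
  \<open>adjoint_iff\<close> below gives the equivalent hom-set form.\<close>

definition adjoint :: "('a, 'q::quantale) ucat \<Rightarrow> ('b, 'q) ucat \<Rightarrow>
    ('a \<Rightarrow> 'b) \<Rightarrow> ('b \<Rightarrow> 'a) \<Rightarrow> bool" where
  "adjoint X Y f g \<longleftrightarrow> is_functor X Y f \<and> is_functor Y X g \<and>
     functor_le X X id (g \<circ> f) \<and> functor_le Y Y (f \<circ> g) id"

lemma arr_compose:
  assumes "is_ucat X" "\<Upsilon> \<in> UF (UF (obj X))" "\<upsilon> \<in> UF (obj X)" "x \<in> obj X"
  shows "Urel (UF (obj X)) (obj X) (arr X) (\<Upsilon>, \<upsilon>) * arr X (\<upsilon>, x) \<le> arr X (umult \<Upsilon>, x)"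
  using assms unfolding is_ucat_def by blast

lemma quantale_mult_mono:
  fixes a b c d :: "'q::quantale"
  assumes "a \<le> b" "c \<le> d"
  shows "a * c \<le> b * d"
proof -
  have *: "x * y \<le> x * z" if "y \<le> z" for x y z :: 'q
  proof -
    have "x * z = x * sup y z" using that by (simp add: sup_absorb2)
    also have "\<dots> = sup (x * y) (x * z)" using mult_Sup_distrib[of x "{y, z}"] by simp
    finally show ?thesis by (metis sup_ge1)
  qed
  have "a * c \<le> a * d" using * assms(2) by blast
  also have "\<dots> \<le> b * d" using *[OF assms(1), of d] by (simp add: mult.commute)
  finally show ?thesis .
qed

lemma functor_le_arr:
  assumes Y: "is_ucat Y" and h: "h \<in> obj X \<rightarrow> obj Y" and k: "k \<in> obj X \<rightarrow> obj Y"
    and hk: "functor_le X Y h k" and \<sigma>: "\<sigma> \<in> UF (obj X)" and y: "y \<in> obj Y"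
  shows "arr Y (filtermap k \<sigma>, y) \<le> arr Y (filtermap h \<sigma>, y)"
proof -
  define \<Upsilon> where "\<Upsilon> = filtermap (\<lambda>x. pt (h x)) \<sigma>"
  have \<Upsilon>: "\<Upsilon> \<in> UF (UF (obj Y))"
    unfolding \<Upsilon>_def using h by (intro UF_filtermap[OF _ \<sigma>] Pi_I UF_pt) auto
  have k\<sigma>: "filtermap k \<sigma> \<in> UF (obj Y)" by (rule UF_filtermap[OF k \<sigma>])
  have m: "umult \<Upsilon> = filtermap h \<sigma>"
    by (simp add: filter_eq_iff eventually_umult \<Upsilon>_def eventually_filtermap eventually_principal)
  have "1 \<le> Urel (UF (obj Y)) (obj Y) (arr Y) (\<Upsilon>, filtermap k \<sigma>)"
  proof -
    have "1 \<le> (SUP (u, z)\<in>A \<times> B. arr Y (u, z))"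
      if A: "eventually (\<lambda>u. u \<in> A) \<Upsilon>" and B: "eventually (\<lambda>z. z \<in> B) (filtermap k \<sigma>)" for A B
    proof -
      have "eventually (\<lambda>x. x \<in> obj X \<and> pt (h x) \<in> A \<and> k x \<in> B) \<sigma>"
        using A B \<sigma> by (simp add: \<Upsilon>_def eventually_filtermap eventually_conj_iff UF_def)
      moreover have "\<sigma> \<noteq> bot" using \<sigma> by (simp add: UF_def is_ultrafilter_def)
      ultimately obtain x where x: "x \<in> obj X" "pt (h x) \<in> A" "k x \<in> B"
        using eventually_happens' by blast
      then have "1 \<le> arr Y (pt (h x), k x)" using hk by (simp add: functor_le_def)
      also have "\<dots> \<le> (SUP (u, z)\<in>A \<times> B. arr Y (u, z))"
        using x SUP_upper[of "(pt (h x), k x)" "A \<times> B" "\<lambda>(u, z). arr Y (u, z)"] by simp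
      finally show ?thesis .
    qed
    then show ?thesis using \<Upsilon> k\<sigma> by (auto simp: Urel_def intro!: INF_greatest)
  qed
  then have "1 * arr Y (filtermap k \<sigma>, y)
      \<le> Urel (UF (obj Y)) (obj Y) (arr Y) (\<Upsilon>, filtermap k \<sigma>) * arr Y (filtermap k \<sigma>, y)"
    by (rule quantale_mult_mono) simp
  also have "\<dots> \<le> arr Y (umult \<Upsilon>, y)" by (rule arr_compose[OF Y \<Upsilon> k\<sigma> y])
  finally show ?thesis by (simp add: m)
qed

lemma arr_mono:
  assumes Y: "is_ucat Y" and \<nu>: "\<nu> \<in> UF (obj Y)" and y: "y \<in> obj Y" and z: "z \<in> obj Y"
    and le: "1 \<le> arr Y (pt z, y)"
  shows "arr Y (\<nu>, z) \<le> arr Y (\<nu>, y)"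
proof -
  have "arr Y (\<nu>, z) \<le> Urel (UF (obj Y)) (obj Y) (arr Y) (pt \<nu>, pt z)"
    using \<nu> z UF_pt[OF \<nu>] UF_pt[OF z]
    by (auto simp: Urel_def eventually_principal intro!: INF_greatest SUP_upper2[of "(\<nu>, z)"])
  then have "arr Y (\<nu>, z) * 1 \<le> Urel (UF (obj Y)) (obj Y) (arr Y) (pt \<nu>, pt z) * arr Y (pt z, y)"
    using le by (rule quantale_mult_mono)
  also have "\<dots> \<le> arr Y (umult (pt \<nu>), y)" by (rule arr_compose[OF Y UF_pt[OF \<nu>] UF_pt[OF z] y])
  also have "umult (pt \<nu>) = \<nu>"
    by (rule filter_eq_iff[THEN iffD2]) (simp add: eventually_umult eventually_principal)
  finally show ?thesis by simp
qed

lemma adjoint_iff: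
  assumes X: "is_ucat X" and Y: "is_ucat Y" and f: "is_functor X Y f" and g: "is_functor Y X g"
  shows "adjoint X Y f g \<longleftrightarrow>
    (\<forall>\<sigma>\<in>UF (obj X). \<forall>y\<in>obj Y. arr Y (filtermap f \<sigma>, y) = arr X (\<sigma>, g y))"
proof
  have fX: "f \<in> obj X \<rightarrow> obj Y" and gY: "g \<in> obj Y \<rightarrow> obj X"
    using f g by (auto simp: is_functor_def)
  {
    assume adj: "adjoint X Y f g"
    show "\<forall>\<sigma>\<in>UF (obj X). \<forall>y\<in>obj Y. arr Y (filtermap f \<sigma>, y) = arr X (\<sigma>, g y)"
    proof (intro ballI order.antisym)
      fix \<sigma> y assume \<sigma>: "\<sigma> \<in> UF (obj X)" and y: "y \<in> obj Y"
      have f\<sigma>: "filtermap f \<sigma> \<in> UF (obj Y)" by (rule UF_filtermap[OF fX \<sigma>])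
      have "arr Y (filtermap f \<sigma>, y) \<le> arr X (filtermap (g \<circ> f) \<sigma>, g y)"
        using g f\<sigma> y by (simp add: is_functor_def filtermap_compose)
      also have "\<dots> \<le> arr X (filtermap id \<sigma>, g y)"
        using adj \<sigma> y fX gY by (intro functor_le_arr[OF X, where X = X]) (auto simp: adjoint_def)
      finally show "arr Y (filtermap f \<sigma>, y) \<le> arr X (\<sigma>, g y)" by (simp add: id_def filtermap_ident)
      have "arr X (\<sigma>, g y) \<le> arr Y (filtermap f \<sigma>, f (g y))"
        using f \<sigma> y gY by (auto simp: is_functor_def)
      also have "\<dots> \<le> arr Y (filtermap f \<sigma>, y)"
        using adj f\<sigma> y fX gY
        by (intro arr_mono[OF Y]) (auto simp: adjoint_def functor_le_def)
      finally show "arr X (\<sigma>, g y) \<le> arr Y (filtermap f \<sigma>, y)" .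
    qed
  }
  assume eq: "\<forall>\<sigma>\<in>UF (obj X). \<forall>y\<in>obj Y. arr Y (filtermap f \<sigma>, y) = arr X (\<sigma>, g y)"
  have "1 \<le> arr X (pt x, g (f x))" if x: "x \<in> obj X" for x
  proof -
    have "arr X (pt x, g (f x)) = arr Y (filtermap f (pt x), f x)"
      using eq UF_pt[OF x] x fX by (metis PiE)
    then show ?thesis using Y x fX by (auto simp: is_ucat_def filtermap_principal)
  qed
  moreover have "1 \<le> arr Y (pt (f (g y)), y)" if y: "y \<in> obj Y" for y
  proof -
    have gy: "g y \<in> obj X" using gY y by blast
    have "arr Y (filtermap f (pt (g y)), y) = arr X (pt (g y), g y)"
      using eq UF_pt[OF gy] y by blast
    then show ?thesis using X gy by (simp add: is_ucat_def filtermap_principal)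
  qed
  ultimately show "adjoint X Y f g"
    using f g by (simp add: adjoint_def functor_le_def)
qed

definition full_sub :: "('a, 'q) ucat \<Rightarrow> 'a set \<Rightarrow> ('a, 'q) ucat" where
  "full_sub X S = \<lparr>obj = S, arr = restrict (arr X) (UF S \<times> S)\<rparr>"

definition quantale_cat :: "('q::quantale, 'q) ucat" where
  "quantale_cat = \<lparr>obj = UNIV, arr = (\<lambda>(\<sigma>, v)\<in>UF UNIV \<times> UNIV. qhom (xi \<sigma>) v)\<rparr>"

definition free_cat :: "('a, 'q::quantale) ucat \<Rightarrow> ('a filter, 'q) ucat" where
  "free_cat X = \<lparr>obj = UF (obj X), arr = graph_rel (UF (UF (obj X))) (UF (obj X)) umult\<rparr>"

text \<open>The one-point category, on an arbitrarily chosen point \<open>s\<close> of the ambient type.\<close>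

definition one_cat :: "'a \<Rightarrow> ('a, 'q::quantale) ucat" where
  "one_cat s = \<lparr>obj = {s}, arr = converse_rel {s} (UF {s}) (graph_rel {s} (UF {s}) pt)\<rparr>"

section \<open>Distributors\<close>

definition is_distributor :: "('a, 'q::quantale) ucat \<Rightarrow> ('b, 'q) ucat \<Rightarrow>
    ('a filter \<times> 'b \<Rightarrow> 'q) \<Rightarrow> bool" where
  "is_distributor X Y \<phi> \<longleftrightarrow> \<phi> \<in> rel (UF (obj X)) (obj Y) \<and>
     kconv (obj X) (obj X) (obj Y) \<phi> (arr X) = \<phi> \<and>
     kconv (obj X) (obj Y) (obj Y) (arr Y) \<phi> = \<phi>"

definition lower_star :: "('a, 'q::quantale) ucat \<Rightarrow> ('b, 'q) ucat \<Rightarrow> ('a \<Rightarrow> 'b) \<Rightarrow>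
    'a filter \<times> 'b \<Rightarrow> 'q" where
  "lower_star X Y f = (\<lambda>(\<sigma>, y)\<in>UF (obj X) \<times> obj Y. arr Y (filtermap f \<sigma>, y))"

definition upper_star :: "('a, 'q::quantale) ucat \<Rightarrow> ('b, 'q) ucat \<Rightarrow> ('a \<Rightarrow> 'b) \<Rightarrow>
    'b filter \<times> 'a \<Rightarrow> 'q" where
  "upper_star X Y f = (\<lambda>(\<nu>, x)\<in>UF (obj Y) \<times> obj X. arr Y (\<nu>, f x))"

definition point_lower :: "'u \<Rightarrow> ('u, 'q::quantale) ucat \<Rightarrow> 'u \<Rightarrow> 'u filter \<times> 'u \<Rightarrow> 'q" where
  "point_lower s X x = lower_star (one_cat s) X (\<lambda>_. x)"

definition point_upper :: "'u \<Rightarrow> ('u, 'q::quantale) ucat \<Rightarrow> 'u \<Rightarrow> 'u filter \<times> 'u \<Rightarrow> 'q" where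
  "point_upper s X x = upper_star (one_cat s) X (\<lambda>_. x)"

text \<open>A map \<open>\<psi>\<close> on \<open>UX\<close> regarded as a relation from \<open>X\<close> to \<open>1\<close>.\<close>

definition to_one :: "'u \<Rightarrow> ('u, 'q::quantale) ucat \<Rightarrow> ('u filter \<Rightarrow> 'q) \<Rightarrow>
    'u filter \<times> 'u \<Rightarrow> 'q" where
  "to_one s X \<psi> = (\<lambda>(\<sigma>, y)\<in>UF (obj X) \<times> {s}. \<psi> \<sigma>)"

definition power_obj :: "('a, 'q::quantale) ucat \<Rightarrow> ('a filter \<Rightarrow> 'q) set" where
  "power_obj X = {\<psi> \<in> UF (obj X) \<rightarrow>\<^sub>E UNIV. is_functor (free_cat X) quantale_cat \<psi>}"

definition power_cat :: "('a, 'q::quantale) ucat \<Rightarrow> ('a filter \<Rightarrow> 'q, 'q) ucat" where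
  "power_cat X = \<lparr>obj = power_obj X,
     arr = (\<lambda>(\<rho>, \<psi>)\<in>UF (power_obj X) \<times> power_obj X.
       INF \<theta>\<in>{\<theta> \<in> UF (UF (obj X) \<times> power_obj X). filtermap snd \<theta> = \<rho>}.
         qhom (xi (filtermap (\<lambda>(\<nu>, \<chi>). \<chi> \<nu>) \<theta>)) (\<psi> (umult (filtermap fst \<theta>))))\<rparr>"

definition presheaf_cat :: "'u \<Rightarrow> ('u, 'q::quantale) ucat \<Rightarrow> ('u filter \<Rightarrow> 'q, 'q) ucat" where
  "presheaf_cat s X =
     full_sub (power_cat X) {\<psi> \<in> power_obj X. is_distributor X (one_cat s) (to_one s X \<psi>)}"

definition yoneda :: "('u, 'q::quantale) ucat \<Rightarrow> 'u \<Rightarrow> 'u filter \<Rightarrow> 'q" where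
  "yoneda X x = (\<lambda>\<sigma>\<in>UF (obj X). arr X (\<sigma>, x))"

section \<open>The class J\<close>

text \<open>
  \<open>J A B\<close> is the set of those distributors from \<open>A\<close> to \<open>B\<close> that belong to the class.
  "All categories" is rendered by all categories whose underlying set is a subset of a
  type \<open>'u\<close>, which is arbitrary (and so as large as one likes); a class on all categories
  restricts to one on these. For a given \<open>X\<close>, the notions below involve \<open>J\<close>
  only through its distributors from \<open>X\<close> to \<open>1\<close> and from \<open>X\<close> to \<open>X\<close>.
  The conditions imply that membership in \<open>J\<close> is invariant under isomorphism of categories;
  in particular the choice of the point \<open>s\<close> is immaterial.
\<close>

type_synonym ('u, 'q) dist_class =
  "('u, 'q) ucat \<Rightarrow> ('u, 'q) ucat \<Rightarrow> ('u filter \<times> 'u \<Rightarrow> 'q) set"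

definition is_dist_class :: "'u \<Rightarrow> ('u, 'q::quantale) dist_class \<Rightarrow> bool" where
  "is_dist_class s J \<longleftrightarrow>
     (\<forall>A B \<phi>. is_ucat A \<and> is_ucat B \<and> \<phi> \<in> J A B \<longrightarrow> is_distributor A B \<phi>) \<and>
     (\<forall>A B C \<phi> \<psi>. is_ucat A \<and> is_ucat B \<and> is_ucat C \<and> \<phi> \<in> J A B \<and> \<psi> \<in> J B C \<longrightarrow>
        kconv (obj A) (obj B) (obj C) \<psi> \<phi> \<in> J A C) \<and>
     (\<forall>A B f. is_ucat A \<and> is_ucat B \<and> is_functor A B f \<longrightarrow> upper_star A B f \<in> J B A) \<and>
     (\<forall>A B \<phi>. is_ucat A \<and> is_ucat B \<and> is_distributor A B \<phi> \<and>
        (\<forall>y\<in>obj B. kconv (obj A) (obj B) {s} (point_upper s B y) \<phi> \<in> J A (one_cat s)) \<longrightarrow>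
        \<phi> \<in> J A B)"

definition J_cat :: "'u \<Rightarrow> ('u, 'q::quantale) dist_class \<Rightarrow> ('u, 'q) ucat \<Rightarrow>
    ('u filter \<Rightarrow> 'q, 'q) ucat" where
  "J_cat s J X = full_sub (presheaf_cat s X)
     {\<psi> \<in> obj (presheaf_cat s X). to_one s X \<psi> \<in> J X (one_cat s)}"

text \<open>\<open>S\<close> is a left adjoint of the Yoneda functor from \<open>X\<close> to \<open>JX\<close>. \<open>X\<close> is
  \<open>J\<close>-cocomplete if such an \<open>S\<close> exists. As \<open>S\<close> is determined only up to isomorphism, the notions
  below that depend on it take it as a parameter.\<close>

definition J_cocomplete :: "'u \<Rightarrow> ('u, 'q::quantale) dist_class \<Rightarrow> ('u, 'q) ucat \<Rightarrow>
    (('u filter \<Rightarrow> 'q) \<Rightarrow> 'u) \<Rightarrow> bool" where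
  "J_cocomplete s J X S \<longleftrightarrow> adjoint (J_cat s J X) X S (yoneda X)"

section \<open>Continuity\<close>

definition J_continuous :: "'u \<Rightarrow> ('u, 'q::quantale) dist_class \<Rightarrow> ('u, 'q) ucat \<Rightarrow>
    (('u filter \<Rightarrow> 'q) \<Rightarrow> 'u) \<Rightarrow> bool" where
  "J_continuous s J X S \<longleftrightarrow> (\<exists>t. adjoint X (J_cat s J X) t S)"

definition is_way_below :: "'u \<Rightarrow> ('u, 'q::quantale) dist_class \<Rightarrow> ('u, 'q) ucat \<Rightarrow>
    (('u filter \<Rightarrow> 'q) \<Rightarrow> 'u) \<Rightarrow> ('u filter \<times> 'u \<Rightarrow> 'q) \<Rightarrow> bool" where
  "is_way_below s J X S w \<longleftrightarrow> is_distributor X X w \<and>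
     (\<forall>\<gamma>. is_distributor X X \<gamma> \<longrightarrow>
        (rel_le (UF (obj X)) (obj (J_cat s J X))
           (kconv (obj X) (obj X) (obj (J_cat s J X)) (upper_star (J_cat s J X) X S) \<gamma>)
           (lower_star X (J_cat s J X) (yoneda X))
         \<longleftrightarrow> rel_le (UF (obj X)) (obj X) \<gamma> w))"

definition is_approximating :: "('u, 'q::quantale) dist_class \<Rightarrow> ('u, 'q) ucat \<Rightarrow>
    ('u filter \<times> 'u \<Rightarrow> 'q) \<Rightarrow> bool" where
  "is_approximating J X v \<longleftrightarrow> is_distributor X X v \<and> v \<in> J X X \<and>
     kext (obj X) (obj X) (obj X) (arr X) v = arr X"

definition is_approximating_at :: "'u \<Rightarrow> ('u, 'q::quantale) dist_class \<Rightarrow> ('u, 'q) ucat \<Rightarrow>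
    ('u filter \<times> 'u \<Rightarrow> 'q) \<Rightarrow> 'u \<Rightarrow> bool" where
  "is_approximating_at s J X v x \<longleftrightarrow> is_distributor X X v \<and> v \<in> J X X \<and>
     kext (obj X) {s} (obj X) (arr X) (kconv (obj X) (obj X) {s} (point_upper s X x) v)
       = point_lower s X x"

definition is_J_cocontinuous :: "'u \<Rightarrow> ('u, 'q::quantale) dist_class \<Rightarrow> ('u, 'q) ucat \<Rightarrow>
    (('u filter \<Rightarrow> 'q) \<Rightarrow> 'u) \<Rightarrow> ('u filter \<times> 'u \<Rightarrow> 'q) \<Rightarrow> bool" where
  "is_J_cocontinuous s J X S v \<longleftrightarrow> is_distributor X X v \<and>
     kconv (obj X) (obj X) (obj (J_cat s J X)) (upper_star (J_cat s J X) X S) v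
       = kconv (obj X) (obj X) (obj (J_cat s J X)) (lower_star X (J_cat s J X) (yoneda X)) v"

end

theory Submission
  imports Defs
begin

text \<open>
  By complete distributivity, \<open>(U\<alpha> \<cdot> m\<^sub>X\<^sup>o\<^sup>p)(\<nu>, \<upsilon>)\<close> is the infimum over \<open>A \<in> \<nu>\<close> and \<open>B \<in> \<upsilon>\<close>
  of the suprema of \<open>\<alpha> (\<sigma>, y)\<close> with \<open>A \<in> \<sigma>\<close> and \<open>y \<in> B\<close>. The structure of the presheaf
  category is then \<open>\<psi> \<circ>- ev\<close> for the evaluation relation \<open>ev\<close>, which makes the category axioms
  for \<open>JX\<close> and the Yoneda lemma short computations.

  A distributor \<open>v\<close> in \<open>J\<close> is the same thing as a functor \<open>t\<close> from \<open>X\<close> to \<open>JX\<close>, via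
  \<open>t x = v (-, x)\<close>. The counit \<open>t (S \<psi>) \<le> \<psi>\<close> of an adjunction between \<open>t\<close> and \<open>S\<close> says that
  \<open>S\<^sup>* \<circ> v \<le> y\<^sub>*\<close>, and it holds both for the way-below distributor and for a \<open>J\<close>-cocontinuous \<open>v\<close>
  below \<open>X\<close>; the unit says that \<open>S (t x)\<close> is isomorphic to \<open>x\<close>, which is approximation at \<open>x\<close>.
\<close>

section \<open>Quantales and ultrafilters\<close>

lemma quantale_le_one: "(a::'q::quantale) \<le> 1"
  by (simp add: one_eq_top)

lemma quantale_mult_bot [simp]: "(a::'q::quantale) * bot = bot" "bot * (a::'q) = bot"
  using mult_Sup_distrib[of a "{}"] by (simp_all add: mult.commute)

text \<open>The tensor preserves suprema, so the supremum defining \<open>qhom a b\<close> itself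
  satisfies \<open>a * c \<le> b\<close>; residuation follows.\<close>

lemma le_qhom_iff: "(c::'q::quantale) \<le> qhom a b \<longleftrightarrow> a * c \<le> b"
proof
  have "a * qhom a b \<le> b"
    unfolding qhom_def mult_Sup_distrib by (rule SUP_least) simp
  then show "a * c \<le> b" if "c \<le> qhom a b"
    using quantale_mult_mono[OF order.refl that, of a] by simp
qed (simp add: qhom_def Sup_upper)

lemma quantale_mult_Sup_le:
  assumes "\<And>b. b \<in> B \<Longrightarrow> (a::'q::quantale) * b \<le> c"
  shows "a * Sup B \<le> c"
  unfolding mult_Sup_distrib using assms by (rule SUP_least)

lemma qhom_SUP: "qhom (SUP i\<in>I. f i) (b::'q::quantale) = (INF i\<in>I. qhom (f i) b)"
proof (rule order.antisym)
  show "qhom (SUP i\<in>I. f i) b \<le> (INF i\<in>I. qhom (f i) b)"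
  proof (rule INF_greatest)
    fix i assume "i \<in> I"
    then have "f i * qhom (SUP i\<in>I. f i) b \<le> (SUP i\<in>I. f i) * qhom (SUP i\<in>I. f i) b"
      by (intro quantale_mult_mono SUP_upper) auto
    also have "\<dots> \<le> b" by (simp flip: le_qhom_iff)
    finally show "qhom (SUP i\<in>I. f i) b \<le> qhom (f i) b" by (simp add: le_qhom_iff)
  qed
  have "(INF i\<in>I. qhom (f i) b) * (SUP i\<in>I. f i) \<le> b"
  proof (rule quantale_mult_Sup_le, safe)
    fix i assume "i \<in> I"
    then have "(INF i\<in>I. qhom (f i) b) \<le> qhom (f i) b" by (rule INF_lower)
    then show "(INF i\<in>I. qhom (f i) b) * f i \<le> b" by (simp add: le_qhom_iff mult.commute)
  qed
  then show "(INF i\<in>I. qhom (f i) b) \<le> qhom (SUP i\<in>I. f i) b"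
    by (simp add: le_qhom_iff mult.commute)
qed

lemma is_ultrafilterD: "is_ultrafilter F \<Longrightarrow> \<not> eventually P F \<Longrightarrow> eventually (\<lambda>x. \<not> P x) F"
  by (auto simp: is_ultrafilter_def)

lemma UF_D:
  assumes "\<sigma> \<in> UF X"
  shows "is_ultrafilter \<sigma>" "eventually (\<lambda>x. x \<in> X) \<sigma>"
  using assms by (auto simp: UF_def)

lemma UF_obtain:
  assumes "\<sigma> \<in> UF X" "eventually P \<sigma>"
  obtains x where "x \<in> X" "P x"
proof -
  have "eventually (\<lambda>x. x \<in> X \<and> P x) \<sigma>" using assms by (simp add: UF_def eventually_conj_iff)
  then show ?thesis
    using that assms(1) eventually_happens'[of \<sigma>] by (auto simp: UF_def is_ultrafilter_def)
qed

lemma UF_filtermap':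
  assumes "\<sigma> \<in> UF X" "eventually (\<lambda>x. f x \<in> Y) \<sigma>"
  shows "filtermap f \<sigma> \<in> UF Y"
  using assms by (auto simp: UF_def is_ultrafilter_def eventually_filtermap filtermap_bot_iff)

lemma UF_mono: "\<sigma> \<in> UF X \<Longrightarrow> eventually (\<lambda>x. x \<in> Y) \<sigma> \<Longrightarrow> \<sigma> \<in> UF Y"
  by (simp add: UF_def)

text \<open>Ultrafilters are minimal proper filters: if \<open>P\<close> is an event of
  \<open>F\<close> but not of \<open>G\<close>, its negation is an event of \<open>G\<close> and
  hence of \<open>F\<close>. Inclusions between ultrafilters thus become equalities.\<close>

lemma ultrafilter_le_eq:
  assumes "is_ultrafilter F" "is_ultrafilter G" "F \<le> G"
  shows "F = G"
proof (rule order.antisym[OF assms(3)], rule filter_leI)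
  fix P assume P: "eventually P F"
  show "eventually P G"
  proof (rule ccontr)
    assume "\<not> eventually P G"
    then have "eventually (\<lambda>x. \<not> P x) F" using assms is_ultrafilterD filter_leD by blast
    with P have "eventually (\<lambda>x. False) F" by eventually_elim simp
    then show False using assms(1) by (simp add: is_ultrafilter_def eventually_False)
  qed
qed

lemma UF_singleton: "UF {x} = {pt x}"
proof (intro equalityI subsetI)
  fix \<sigma> assume \<sigma>: "\<sigma> \<in> UF {x}"
  then have "\<sigma> \<le> pt x" by (simp add: UF_def le_principal)
  with \<sigma> UF_pt[of x UNIV] have "\<sigma> = pt x" using ultrafilter_le_eq[of \<sigma> "pt x"] by (auto simp: UF_def)
  then show "\<sigma> \<in> {pt x}" by simp
qed (simp add: UF_pt)

lemma UF_umult: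
  assumes "\<Upsilon> \<in> UF (UF X)"
  shows "umult \<Upsilon> \<in> UF X"
proof -
  have ev: "eventually (\<lambda>\<sigma>. \<sigma> \<in> UF X) \<Upsilon>" using assms by (simp add: UF_def)
  have "umult \<Upsilon> \<noteq> bot"
  proof
    assume "umult \<Upsilon> = bot"
    then have "eventually (\<lambda>\<sigma>. eventually (\<lambda>x. False) \<sigma>) \<Upsilon>"
      by (metis eventually_umult eventually_bot)
    then obtain \<sigma> where "\<sigma> \<in> UF X" "eventually (\<lambda>x. False) \<sigma>" using assms UF_obtain by blast
    then show False by (auto elim: UF_obtain)
  qed
  moreover have "eventually P (umult \<Upsilon>) \<or> eventually (\<lambda>x. \<not> P x) (umult \<Upsilon>)" for P
  proof (cases "eventually P (umult \<Upsilon>)")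
    case False
    \<comment> \<open>The outer ultrafilter decides whether \<open>P\<close> is an event of
      \<sigma>; almost every inner \<sigma> is an ultrafilter and turns the failure of
      \<open>P\<close> into its negation.\<close>
    then have "eventually (\<lambda>\<sigma>. \<not> eventually P \<sigma>) \<Upsilon>"
      using UF_D(1)[OF assms] by (simp add: eventually_umult is_ultrafilterD)
    with ev have "eventually (\<lambda>\<sigma>. eventually (\<lambda>x. \<not> P x) \<sigma>) \<Upsilon>"
      by eventually_elim (use UF_D(1) is_ultrafilterD in blast)
    then show ?thesis by (simp add: eventually_umult)
  qed simp
  moreover have "eventually (\<lambda>\<sigma>. eventually (\<lambda>x. x \<in> X) \<sigma>) \<Upsilon>"
    using ev by eventually_elim (rule UF_D(2))
  ultimately show ?thesis by (simp add: UF_def is_ultrafilter_def eventually_umult)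
qed

text \<open>The ultrafilter lemma: Zorn's lemma for the reversed order gives a minimal proper filter
  below \<open>F\<close>, and minimality makes it decide every predicate.\<close>

lemma ultrafilter_below:
  assumes F: "F \<noteq> bot"
  obtains G where "is_ultrafilter G" "G \<le> F"
proof -
  let ?A = "{G. G \<noteq> bot \<and> G \<le> F}" and ?P = "\<lambda>G H :: 'a filter. H \<le> G"
  have "\<exists>m\<in>?A. \<forall>a\<in>?A. ?P m a \<longrightarrow> a = m"
  proof (rule predicate_Zorn)
    show "partial_order_on ?A (relation_of ?P ?A)"
      by (auto intro!: partial_order_on_relation_ofI)
    fix C assume "C \<in> Chains (relation_of ?P ?A)"
    then have C: "C \<subseteq> ?A" and chain: "\<And>G H. G \<in> C \<Longrightarrow> H \<in> C \<Longrightarrow> G \<le> H \<or> H \<le> G"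
      by (auto simp: Chains_def relation_of_def)
    show "\<exists>u\<in>?A. \<forall>a\<in>C. ?P a u"
    proof (cases "C = {}")
      case False
      \<comment> \<open>A nonempty chain is directed, so every event of its infimum is an event of
        some member; hence the infimum stays proper.\<close>
      have "eventually P (Inf C) \<longleftrightarrow> (\<exists>b\<in>C. eventually P b)" for P
        using False chain by (intro eventually_Inf_base) (metis inf.idem inf_absorb1 inf_absorb2 order.refl)+
      with C have "Inf C \<noteq> bot" unfolding trivial_limit_def by blast
      moreover have "Inf C \<le> F" using False C by (auto intro: Inf_lower2)
      ultimately show ?thesis by (intro bexI[of _ "Inf C"]) (auto intro: Inf_lower)
    qed (use F in auto)
  qed
  then obtain G where G: "G \<noteq> bot" "G \<le> F"
    and min: "\<And>H. H \<noteq> bot \<Longrightarrow> H \<le> G \<Longrightarrow> H = G"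
    by (auto intro: order.trans)
  have "eventually P G \<or> eventually (\<lambda>x. \<not> P x) G" for P
  proof (cases "eventually P G")
    case False
    \<comment> \<open>Adjoining the negation of a predicate that is not an event keeps
      \<open>G\<close> proper, so minimality forces that negation to be in \<open>G\<close>
      already.\<close>
    let ?H = "inf G (principal {x. \<not> P x})"
    have "?H \<noteq> bot" using False by (simp add: trivial_limit_def eventually_inf_principal)
    then have "?H = G" by (rule min) simp
    moreover have "eventually (\<lambda>x. \<not> P x) ?H" by (simp add: eventually_inf_principal)
    ultimately show ?thesis by simp
  qed simp
  with G that show ?thesis by (auto simp: is_ultrafilter_def)
qed

section \<open>The lifting of a relation\<close>

text \<open>
  A closed form of \<open>U\<alpha> \<cdot> m\<^sub>X\<^sup>o\<^sup>p\<close>, see \<open>Ulift_eq_klift\<close>. It does not mention the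
  codomain \<open>Y\<close> of \<open>\<alpha>\<close>, since only sets contained in \<open>Y\<close> matter when \<open>\<upsilon>\<close> is an ultrafilter
  on \<open>Y\<close>.
\<close>

definition klift :: "'a set \<Rightarrow> ('a filter \<times> 'b \<Rightarrow> 'q::quantale) \<Rightarrow> 'a filter \<Rightarrow> 'b filter \<Rightarrow> 'q" where
  "klift X \<alpha> \<nu> \<upsilon> = (INF (P, R)\<in>{P. eventually P \<nu>} \<times> {R. eventually R \<upsilon>}.
     SUP p\<in>{(\<sigma>, y). \<sigma> \<in> UF X \<and> eventually P \<sigma> \<and> R y}. \<alpha> p)"

text \<open>The finite intersection property for the pairs on which \<alpha> is at least
  \<open>u\<close>; \<open>klift_above_witness\<close> extracts from it an ultrafilter of pairs
  lying over \<nu> and \<upsilon>.\<close>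

definition klift_above :: "'a set \<Rightarrow> ('a filter \<times> 'b \<Rightarrow> 'q::quantale) \<Rightarrow> 'q \<Rightarrow>
    'a filter \<Rightarrow> 'b filter \<Rightarrow> bool" where
  "klift_above X \<alpha> u \<nu> \<upsilon> \<longleftrightarrow> (\<forall>P R. eventually P \<nu> \<longrightarrow> eventually R \<upsilon> \<longrightarrow>
     (\<exists>\<sigma>\<in>UF X. \<exists>y. eventually P \<sigma> \<and> R y \<and> u \<le> \<alpha> (\<sigma>, y)))"

lemma klift_above_le:
  assumes "klift_above X \<alpha> u \<nu> \<upsilon>"
  shows "u \<le> klift X \<alpha> \<nu> \<upsilon>"
  unfolding klift_def
proof (rule INF_greatest, clarify)
  fix P R assume "eventually P \<nu>" "eventually R \<upsilon>"
  then obtain \<sigma> y where "\<sigma> \<in> UF X" "eventually P \<sigma>" "R y" "u \<le> \<alpha> (\<sigma>, y)"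
    using assms unfolding klift_above_def by blast
  then show "u \<le> (SUP p\<in>{(\<sigma>, y). \<sigma> \<in> UF X \<and> eventually P \<sigma> \<and> R y}. \<alpha> p)"
    by (intro SUP_upper2[of "(\<sigma>, y)"]) auto
qed

text \<open>By complete distributivity, the lifting is determined by the two-valued relations
  \<open>{(\<sigma>, y). u \<le> \<alpha> (\<sigma>, y)}\<close>.\<close>

lemma klift_eq_Sup:
  fixes \<upsilon> :: "'b filter"
  shows "klift X \<alpha> \<nu> \<upsilon> = Sup {u. klift_above X \<alpha> u \<nu> \<upsilon>}"
proof (rule order.antisym)
  define E where "E = (\<lambda>(P, R). {(\<sigma>, y :: 'b). \<sigma> \<in> UF X \<and> eventually P \<sigma> \<and> R y})"
  define D where "D = E ` ({P. eventually P \<nu>} \<times> {R. eventually R \<upsilon>})"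
  have "klift X \<alpha> \<nu> \<upsilon> = (INF B\<in>D. Sup (\<alpha> ` B))"
    by (simp add: klift_def D_def E_def image_image case_prod_unfold)
  also have "\<dots> = (SUP C\<in>{c ` D |c. \<forall>B\<in>D. c B \<in> B}. Inf (\<alpha> ` C))"
    by (rule INF_SUP_set)
  also have "\<dots> \<le> Sup {u. klift_above X \<alpha> u \<nu> \<upsilon>}"
  proof (rule SUP_least)
    fix C assume "C \<in> {c ` D |c. \<forall>B\<in>D. c B \<in> B}"
    then obtain c where C: "C = c ` D" and c: "\<And>B. B \<in> D \<Longrightarrow> c B \<in> B" by blast
    \<comment> \<open>A choice function picks one pair from each test set, so the infimum of
      \<alpha> over its range is a level attained in every test set.\<close>
    have "klift_above X \<alpha> (Inf (\<alpha> ` C)) \<nu> \<upsilon>"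
      unfolding klift_above_def
    proof (intro allI impI)
      fix P R assume "eventually P \<nu>" "eventually R \<upsilon>"
      then have PR: "E (P, R) \<in> D" by (auto simp: D_def)
      obtain \<sigma> y where y: "c (E (P, R)) = (\<sigma>, y)" by (meson surj_pair)
      have "Inf (\<alpha> ` C) \<le> \<alpha> (\<sigma>, y)" using PR C y by (intro INF_lower) (metis imageI)
      with c[OF PR] y show "\<exists>\<sigma>\<in>UF X. \<exists>y. eventually P \<sigma> \<and> R y \<and> Inf (\<alpha> ` C) \<le> \<alpha> (\<sigma>, y)"
        by (auto simp: E_def)
    qed
    then show "Inf (\<alpha> ` C) \<le> Sup {u. klift_above X \<alpha> u \<nu> \<upsilon>}" by (simp add: Sup_upper)
  qed
  finally show "klift X \<alpha> \<nu> \<upsilon> \<le> Sup {u. klift_above X \<alpha> u \<nu> \<upsilon>}" .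
qed (rule Sup_least, simp add: klift_above_le)

lemma klift_mono:
  assumes \<upsilon>: "\<upsilon> \<in> UF Y" and le: "\<And>\<sigma> y. \<sigma> \<in> UF X \<Longrightarrow> y \<in> Y \<Longrightarrow> \<alpha> (\<sigma>, y) \<le> \<beta> (\<sigma>, y)"
  shows "klift X \<alpha> \<nu> \<upsilon> \<le> klift X \<beta> \<nu> \<upsilon>"
  unfolding klift_eq_Sup
proof (rule Sup_subset_mono, safe)
  fix u assume u: "klift_above X \<alpha> u \<nu> \<upsilon>"
  show "klift_above X \<beta> u \<nu> \<upsilon>"
    unfolding klift_above_def
  proof (intro allI impI)
    fix P R assume "eventually P \<nu>" "eventually R \<upsilon>"
    moreover from this have "eventually (\<lambda>y. R y \<and> y \<in> Y) \<upsilon>"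
      using UF_D(2)[OF \<upsilon>] by (simp add: eventually_conj_iff)
    ultimately obtain \<sigma> y where "\<sigma> \<in> UF X" "eventually P \<sigma>" "R y" "y \<in> Y" "u \<le> \<alpha> (\<sigma>, y)"
      using u unfolding klift_above_def by blast
    then show "\<exists>\<sigma>\<in>UF X. \<exists>y. eventually P \<sigma> \<and> R y \<and> u \<le> \<beta> (\<sigma>, y)"
      using le order.trans by blast
  qed
qed

lemma klift_cong:
  assumes "\<upsilon> \<in> UF Y" "\<And>\<sigma> y. \<sigma> \<in> UF X \<Longrightarrow> y \<in> Y \<Longrightarrow> \<alpha> (\<sigma>, y) = \<beta> (\<sigma>, y)"
  shows "klift X \<alpha> \<nu> \<upsilon> = klift X \<beta> \<nu> \<upsilon>"
  using assms by (intro order.antisym klift_mono) auto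

text \<open>Preimages of events of \<open>filtermap f \<upsilon>\<close> are events of \<upsilon>,
  and images of events are events, so the same values are tested. With \<open>eval_rel\<close> in
  place of \<alpha>, this replaces an image ultrafilter of presheaves by a relation on the original
  points.\<close>

lemma klift_filtermap: "klift X \<alpha> \<nu> (filtermap f \<upsilon>) = klift X (\<lambda>(\<sigma>, y). \<alpha> (\<sigma>, f y)) \<nu> \<upsilon>"
proof -
  have "klift_above X \<alpha> u \<nu> (filtermap f \<upsilon>) \<longleftrightarrow> klift_above X (\<lambda>(\<sigma>, y). \<alpha> (\<sigma>, f y)) u \<nu> \<upsilon>" for u
    unfolding klift_above_def
  proof (intro iffI allI impI)
    fix P R
    assume *: "\<forall>P R. eventually P \<nu> \<longrightarrow> eventually R (filtermap f \<upsilon>) \<longrightarrow>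
        (\<exists>\<sigma>\<in>UF X. \<exists>y. eventually P \<sigma> \<and> R y \<and> u \<le> \<alpha> (\<sigma>, y))"
      and P: "eventually P \<nu>" and R: "eventually R \<upsilon>"
    then have "eventually (\<lambda>z. \<exists>y. f y = z \<and> R y) (filtermap f \<upsilon>)"
      by (auto simp: eventually_filtermap elim: eventually_mono)
    with * P show "\<exists>\<sigma>\<in>UF X. \<exists>y. eventually P \<sigma> \<and> R y \<and> u \<le> (case (\<sigma>, y) of (\<sigma>, y) \<Rightarrow> \<alpha> (\<sigma>, f y))"
      by fastforce
  next
    fix P R
    assume *: "\<forall>P R. eventually P \<nu> \<longrightarrow> eventually R \<upsilon> \<longrightarrow>
        (\<exists>\<sigma>\<in>UF X. \<exists>y. eventually P \<sigma> \<and> R y \<and> u \<le> (case (\<sigma>, y) of (\<sigma>, y) \<Rightarrow> \<alpha> (\<sigma>, f y)))"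
      and P: "eventually P \<nu>" and R: "eventually R (filtermap f \<upsilon>)"
    then have "eventually (\<lambda>y. R (f y)) \<upsilon>" by (simp add: eventually_filtermap)
    with * P show "\<exists>\<sigma>\<in>UF X. \<exists>y. eventually P \<sigma> \<and> R y \<and> u \<le> \<alpha> (\<sigma>, y)"
      by fastforce
  qed
  then show ?thesis by (simp add: klift_eq_Sup)
qed

text \<open>The pair \<open>(\<nu>, y)\<close> itself lies in every test set.\<close>

lemma le_klift_pt:
  assumes "\<nu> \<in> UF X"
  shows "\<alpha> (\<nu>, y) \<le> klift X \<alpha> \<nu> (pt y)"
  by (rule klift_above_le) (use assms in \<open>auto simp: klift_above_def eventually_principal\<close>)

text \<open>A point \<open>x\<close> common to both events yields the test pair
  \<open>(pt x, x)\<close>. This is the lifted form of reflexivity.\<close>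

lemma one_le_klift_refl:
  assumes "\<nu> \<in> UF X" "\<And>x. x \<in> X \<Longrightarrow> 1 \<le> \<alpha> (pt x, x)"
  shows "1 \<le> klift X \<alpha> \<nu> \<nu>"
proof (rule klift_above_le, unfold klift_above_def, intro allI impI)
  fix P R assume "eventually P \<nu>" "eventually R \<nu>"
  then have "eventually (\<lambda>x. P x \<and> R x) \<nu>" by (simp add: eventually_conj_iff)
  with assms(1) obtain x where "x \<in> X" "P x" "R x" by (rule UF_obtain) blast
  then show "\<exists>\<sigma>\<in>UF X. \<exists>y. eventually P \<sigma> \<and> R y \<and> 1 \<le> \<alpha> (\<sigma>, y)"
    using assms(2) by (intro bexI[of _ "pt x"] exI[of _ x]) (auto simp: eventually_principal UF_pt)
qed

text \<open>The intermediate ultrafilter \<open>\<sigma>\<close> is the multiplication of the image of \<open>\<upsilon>'\<close> under a choice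
  function \<open>g\<close>.\<close>

lemma klift_compose:
  assumes \<nu>: "\<nu> \<in> UF X" and \<upsilon>: "\<upsilon> \<in> UF Y" and \<omega>: "\<omega> \<in> UF Z"
    and le: "\<And>\<sigma> \<upsilon>' z. \<sigma> \<in> UF X \<Longrightarrow> \<upsilon>' \<in> UF Y \<Longrightarrow> z \<in> Z \<Longrightarrow>
      klift X \<alpha> \<sigma> \<upsilon>' * \<beta> (\<upsilon>', z) \<le> \<gamma> (\<sigma>, z)"
  shows "klift X \<alpha> \<nu> \<upsilon> * klift Y \<beta> \<upsilon> \<omega> \<le> klift X \<gamma> \<nu> \<omega>"
proof -
  have *: "u * v \<le> klift X \<gamma> \<nu> \<omega>"
    if u: "klift_above X \<alpha> u \<nu> \<upsilon>" and v: "klift_above Y \<beta> v \<upsilon> \<omega>" for u v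
  proof (rule klift_above_le, unfold klift_above_def, intro allI impI)
    fix P R assume P: "eventually P \<nu>" and R: "eventually R \<omega>"
    define B where "B y \<longleftrightarrow> (\<exists>\<sigma>\<in>UF X. eventually P \<sigma> \<and> u \<le> \<alpha> (\<sigma>, y))" for y
    \<comment> \<open>Otherwise the complement of \<open>B\<close> is an event of \<upsilon>, and
      testing \<open>u\<close> on \<open>P\<close> and this complement produces a point both in
      \<open>B\<close> and outside it.\<close>
    have "eventually B \<upsilon>"
    proof (rule ccontr)
      assume "\<not> eventually B \<upsilon>"
      then have "eventually (\<lambda>y. \<not> B y) \<upsilon>" using \<upsilon> by (simp add: UF_D(1) is_ultrafilterD)
      with u P show False unfolding klift_above_def B_def by blast
    qed
    moreover have "eventually (\<lambda>z. R z \<and> z \<in> Z) \<omega>"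
      using R UF_D(2)[OF \<omega>] by (simp add: eventually_conj_iff)
    ultimately obtain \<upsilon>' z where \<upsilon>': "\<upsilon>' \<in> UF Y" "eventually B \<upsilon>'" and z: "R z" "z \<in> Z" "v \<le> \<beta> (\<upsilon>', z)"
      using v unfolding klift_above_def by blast
    have "\<forall>y. \<exists>\<sigma>. B y \<longrightarrow> \<sigma> \<in> UF X \<and> eventually P \<sigma> \<and> u \<le> \<alpha> (\<sigma>, y)"
      unfolding B_def by blast
    from choice[OF this] obtain g
      where g: "\<And>y. B y \<Longrightarrow> g y \<in> UF X \<and> eventually P (g y) \<and> u \<le> \<alpha> (g y, y)"
      by blast
    define \<sigma> where "\<sigma> = umult (filtermap g \<upsilon>')"
    have \<sigma>: "\<sigma> \<in> UF X"
      unfolding \<sigma>_def using \<upsilon>' g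
      by (intro UF_umult UF_filtermap'[OF \<upsilon>'(1)]) (auto elim: eventually_mono)
    have P\<sigma>: "eventually P \<sigma>"
      unfolding \<sigma>_def eventually_umult eventually_filtermap
      using \<upsilon>'(2) by eventually_elim (simp add: g)
    have "klift_above X \<alpha> u \<sigma> \<upsilon>'"
      unfolding klift_above_def
    proof (intro allI impI)
      fix P' R' assume "eventually P' \<sigma>" "eventually R' \<upsilon>'"
      then have "eventually (\<lambda>y. eventually P' (g y) \<and> R' y \<and> B y) \<upsilon>'"
        using \<upsilon>'(2) by (simp add: \<sigma>_def eventually_umult eventually_filtermap eventually_conj_iff)
      with \<upsilon>'(1) obtain y where "eventually P' (g y)" "R' y" "B y" by (rule UF_obtain) blast
      then show "\<exists>\<sigma>\<in>UF X. \<exists>y. eventually P' \<sigma> \<and> R' y \<and> u \<le> \<alpha> (\<sigma>, y)" using g by blast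
    qed
    then have "u * v \<le> klift X \<alpha> \<sigma> \<upsilon>' * \<beta> (\<upsilon>', z)"
      using z by (intro quantale_mult_mono klift_above_le)
    also have "\<dots> \<le> \<gamma> (\<sigma>, z)" using \<sigma> \<upsilon>'(1) z(2) by (rule le)
    finally show "\<exists>\<sigma>\<in>UF X. \<exists>z. eventually P \<sigma> \<and> R z \<and> u * v \<le> \<gamma> (\<sigma>, z)"
      using \<sigma> P\<sigma> z(1) by blast
  qed
  have "klift Y \<beta> \<upsilon> \<omega> * u \<le> klift X \<gamma> \<nu> \<omega>" if "klift_above X \<alpha> u \<nu> \<upsilon>" for u
    unfolding klift_eq_Sup[of Y] mult.commute[of _ u]
    by (rule quantale_mult_Sup_le) (use that * in auto)
  then show ?thesis
    unfolding klift_eq_Sup[of X \<alpha>] mult.commute[of _ "klift Y \<beta> \<upsilon> \<omega>"]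
    by (intro quantale_mult_Sup_le) auto
qed

section \<open>The lifting as a supremum of values of \<xi>\<close>

lemma xi_le_SUP: "eventually P \<sigma> \<Longrightarrow> xi (filtermap f \<sigma>) \<le> (SUP x\<in>{x. P x}. f x)"
  unfolding xi_def
  by (rule INF_lower) (auto simp: eventually_filtermap elim: eventually_mono)

lemma le_xi:
  assumes \<sigma>: "\<sigma> \<in> UF X" and "eventually (\<lambda>x. u \<le> f x) \<sigma>"
  shows "u \<le> xi (filtermap f \<sigma>)"
  unfolding xi_def
proof (rule INF_greatest, simp add: eventually_filtermap)
  fix A assume "eventually (\<lambda>x. f x \<in> A) \<sigma>"
  with assms have "eventually (\<lambda>x. f x \<in> A \<and> u \<le> f x) \<sigma>" by (simp add: eventually_conj_iff)
  with \<sigma> obtain x where "f x \<in> A" "u \<le> f x" by (rule UF_obtain) blast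
  then show "u \<le> Sup A" by (meson Sup_upper2)
qed

lemma xi_le_klift:
  assumes \<theta>: "\<theta> \<in> UF (UF X \<times> Y)"
  shows "xi (filtermap \<alpha> \<theta>) \<le> klift X \<alpha> (umult (filtermap fst \<theta>)) (filtermap snd \<theta>)"
  unfolding klift_def
proof (rule INF_greatest, clarify)
  fix P R assume "eventually P (umult (filtermap fst \<theta>))" "eventually R (filtermap snd \<theta>)"
  then have "eventually (\<lambda>p. eventually P (fst p)) \<theta>" "eventually (\<lambda>p. R (snd p)) \<theta>"
    by (simp_all add: eventually_umult eventually_filtermap)
  with UF_D(2)[OF \<theta>] have "eventually (\<lambda>p. p \<in> {(\<sigma>, y). \<sigma> \<in> UF X \<and> eventually P \<sigma> \<and> R y}) \<theta>"
    by eventually_elim auto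
  then show "xi (filtermap \<alpha> \<theta>) \<le> (SUP p\<in>{(\<sigma>, y). \<sigma> \<in> UF X \<and> eventually P \<sigma> \<and> R y}. \<alpha> p)"
    using xi_le_SUP by force
qed

text \<open>The test sets at level \<open>u\<close> form a filter base of nonempty sets; any
  ultrafilter finer than the generated filter has the required projections.\<close>

lemma klift_above_witness:
  assumes \<nu>: "\<nu> \<in> UF X" and \<upsilon>: "\<upsilon> \<in> UF Y" and u: "klift_above X \<alpha> u \<nu> \<upsilon>"
  obtains \<theta> where "\<theta> \<in> UF (UF X \<times> Y)" "umult (filtermap fst \<theta>) = \<nu>" "filtermap snd \<theta> = \<upsilon>"
    "u \<le> xi (filtermap \<alpha> \<theta>)"
proof -
  define I where "I = {P. eventually P \<nu>} \<times> {R. eventually R \<upsilon>}"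
  define E where "E = (\<lambda>(P, R). {(\<sigma>, y). \<sigma> \<in> UF X \<and> y \<in> Y \<and> eventually P \<sigma> \<and> R y \<and> u \<le> \<alpha> (\<sigma>, y)})"
  define F where "F = (INF i\<in>I. principal (E i))"
  have F: "eventually S F \<longleftrightarrow> (\<exists>i\<in>I. \<forall>p\<in>E i. S p)" for S
  proof -
    have "eventually S F \<longleftrightarrow> (\<exists>i\<in>I. eventually S (principal (E i)))"
      unfolding F_def
    proof (rule eventually_INF_base)
      show "I \<noteq> {}" by (auto simp: I_def intro: exI[of _ "\<lambda>_. True"])
      fix i j assume ij: "i \<in> I" "j \<in> I"
      obtain P R P' R' where i: "i = (P, R)" and j: "j = (P', R')" by (meson surj_pair)
      show "\<exists>k\<in>I. principal (E k) \<le> inf (principal (E i)) (principal (E j))"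
        using ij
        by (intro bexI[of _ "(\<lambda>x. P x \<and> P' x, \<lambda>y. R y \<and> R' y)"])
          (auto simp: i j I_def E_def eventually_conj_iff)
    qed
    then show ?thesis by (simp add: eventually_principal)
  qed
  have "E i \<noteq> {}" if "i \<in> I" for i
  proof -
    obtain P R where i: "i = (P, R)" by (meson surj_pair)
    with that have "eventually P \<nu>" "eventually (\<lambda>y. R y \<and> y \<in> Y) \<upsilon>"
      using UF_D(2)[OF \<upsilon>] by (auto simp: I_def eventually_conj_iff)
    with u show ?thesis unfolding klift_above_def i E_def by fastforce
  qed
  then have "F \<noteq> bot" unfolding trivial_limit_def F by blast
  then obtain \<theta> where \<theta>: "is_ultrafilter \<theta>" "\<theta> \<le> F" by (rule ultrafilter_below)
  have ev: "eventually S \<theta>" if "eventually P \<nu>" "eventually R \<upsilon>"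
    "\<And>\<sigma> y. \<sigma> \<in> UF X \<Longrightarrow> y \<in> Y \<Longrightarrow> eventually P \<sigma> \<Longrightarrow> R y \<Longrightarrow> u \<le> \<alpha> (\<sigma>, y) \<Longrightarrow> S (\<sigma>, y)" for P R S
    using \<theta>(2)
  proof (rule filter_leD)
    show "eventually S F" unfolding F using that
      by (intro bexI[of _ "(P, R)"]) (auto simp: I_def E_def)
  qed
  \<comment> \<open>With trivial events, this says that \<theta> is concentrated on pairs of
    \<open>UF X \<times> Y\<close> where \<alpha> is at least \<open>u\<close>.\<close>
  note ev' = ev[of "\<lambda>_. True" "\<lambda>_. True", simplified]
  have \<theta>U: "\<theta> \<in> UF (UF X \<times> Y)" using \<theta>(1) ev' by (simp add: UF_def)
  have fst: "filtermap fst \<theta> \<in> UF (UF X)" and snd: "filtermap snd \<theta> \<in> UF Y"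
    using \<theta>U by (auto intro!: UF_filtermap[OF _ \<theta>U])
  \<comment> \<open>For both projections only one inclusion is checked; minimality of ultrafilters
    gives equality.\<close>
  have "umult (filtermap fst \<theta>) \<le> \<nu>"
    by (rule filter_leI) (auto simp: eventually_umult eventually_filtermap intro: ev[of _ "\<lambda>_. True"])
  then have m: "umult (filtermap fst \<theta>) = \<nu>"
    using UF_D(1)[OF UF_umult[OF fst]] UF_D(1)[OF \<nu>] by (intro ultrafilter_le_eq)
  have "filtermap snd \<theta> \<le> \<upsilon>"
    by (rule filter_leI) (auto simp: eventually_filtermap intro: ev[of "\<lambda>_. True"])
  then have "filtermap snd \<theta> = \<upsilon>"
    using UF_D(1)[OF snd] UF_D(1)[OF \<upsilon>] by (intro ultrafilter_le_eq)
  moreover have "u \<le> xi (filtermap \<alpha> \<theta>)" by (rule le_xi[OF \<theta>U]) (rule ev')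
  ultimately show ?thesis using that \<theta>U m by blast
qed

text \<open>Links the lifting to the structure of \<open>power_cat\<close>, which is an infimum over
  such \<theta>, and bounds the lifting by terms of \<open>Ulift\<close>.\<close>

lemma klift_eq_SUP_xi:
  assumes "\<nu> \<in> UF X" "\<upsilon> \<in> UF Y"
  shows "klift X \<alpha> \<nu> \<upsilon> =
    (SUP \<theta>\<in>{\<theta> \<in> UF (UF X \<times> Y). umult (filtermap fst \<theta>) = \<nu> \<and> filtermap snd \<theta> = \<upsilon>}.
       xi (filtermap \<alpha> \<theta>))"
proof (rule order.antisym)
  show "klift X \<alpha> \<nu> \<upsilon> \<le>
    (SUP \<theta>\<in>{\<theta> \<in> UF (UF X \<times> Y). umult (filtermap fst \<theta>) = \<nu> \<and> filtermap snd \<theta> = \<upsilon>}.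
       xi (filtermap \<alpha> \<theta>))"
    unfolding klift_eq_Sup
  proof (rule Sup_least, clarify)
    fix u assume "klift_above X \<alpha> u \<nu> \<upsilon>"
    with assms obtain \<theta> where "\<theta> \<in> UF (UF X \<times> Y)" "umult (filtermap fst \<theta>) = \<nu>"
      "filtermap snd \<theta> = \<upsilon>" "u \<le> xi (filtermap \<alpha> \<theta>)" by (rule klift_above_witness)
    then show "u \<le> (SUP \<theta>\<in>{\<theta> \<in> UF (UF X \<times> Y). umult (filtermap fst \<theta>) = \<nu> \<and> filtermap snd \<theta> = \<upsilon>}.
       xi (filtermap \<alpha> \<theta>))" by (intro SUP_upper2[of \<theta>]) auto
  qed
qed (auto intro!: SUP_least xi_le_klift)

section \<open>Comparison with the extension of relations and Kleisli convolution\<close>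

lemma Urel_le_klift:
  assumes \<Upsilon>: "\<Upsilon> \<in> UF (UF X)" and \<upsilon>: "\<upsilon> \<in> UF Y"
  shows "Urel (UF X) Y \<alpha> (\<Upsilon>, \<upsilon>) \<le> klift X \<alpha> (umult \<Upsilon>) \<upsilon>"
  unfolding klift_def
proof (rule INF_greatest, clarify)
  fix P R assume PR: "eventually P (umult \<Upsilon>)" "eventually R \<upsilon>"
  define A where "A = {\<sigma> \<in> UF X. eventually P \<sigma>}"
  define B where "B = {y \<in> Y. R y}"
  have "eventually (\<lambda>\<sigma>. \<sigma> \<in> A) \<Upsilon>" "eventually (\<lambda>y. y \<in> B) \<upsilon>"
    using PR UF_D(2)[OF \<Upsilon>] UF_D(2)[OF \<upsilon>] by (simp_all add: A_def B_def eventually_umult eventually_conj_iff)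
  then have "Urel (UF X) Y \<alpha> (\<Upsilon>, \<upsilon>) \<le> (SUP (\<sigma>, y)\<in>A \<times> B. \<alpha> (\<sigma>, y))"
    using \<Upsilon> \<upsilon> unfolding Urel_def
    by (simp del: INF_le_SUP) (rule INF_lower2[of "(A, B)"], auto simp: A_def B_def)
  also have "\<dots> \<le> (SUP p\<in>{(\<sigma>, y). \<sigma> \<in> UF X \<and> eventually P \<sigma> \<and> R y}. \<alpha> p)"
    by (auto simp: A_def B_def intro!: SUP_least SUP_upper)
  finally show "Urel (UF X) Y \<alpha> (\<Upsilon>, \<upsilon>) \<le> \<dots>" .
qed

lemma xi_le_Urel:
  assumes \<theta>: "\<theta> \<in> UF (UF X \<times> Y)"
  shows "xi (filtermap \<alpha> \<theta>) \<le> Urel (UF X) Y \<alpha> (filtermap fst \<theta>, filtermap snd \<theta>)"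
proof -
  have "filtermap fst \<theta> \<in> UF (UF X)" "filtermap snd \<theta> \<in> UF Y"
    by (auto intro!: UF_filtermap[OF _ \<theta>])
  moreover have "xi (filtermap \<alpha> \<theta>) \<le> (SUP (\<sigma>, y)\<in>A \<times> B. \<alpha> (\<sigma>, y))"
    if "eventually (\<lambda>\<sigma>. \<sigma> \<in> A) (filtermap fst \<theta>)" "eventually (\<lambda>y. y \<in> B) (filtermap snd \<theta>)" for A B
  proof -
    have "eventually (\<lambda>p. p \<in> A \<times> B) \<theta>"
      using that by (simp add: eventually_filtermap mem_Times_iff eventually_conj_iff)
    then show ?thesis using xi_le_SUP[of "\<lambda>p. p \<in> A \<times> B" \<theta> \<alpha>] by (simp add: case_prod_unfold)
  qed
  ultimately show ?thesis by (auto simp: Urel_def intro!: INF_greatest)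
qed

text \<open>\<open>Ulift\<close> is a supremum of values of \<open>Urel\<close> over all \<Upsilon>
  with \<open>umult \<Upsilon> = \<nu>\<close>. Each is below the lifting, while each \<xi>-value in
  \<open>klift_eq_SUP_xi\<close> is below the value at \<Upsilon> =
  \<open>filtermap fst \<theta>\<close>.\<close>

lemma Ulift_eq_klift:
  assumes \<nu>: "\<nu> \<in> UF X" and \<upsilon>: "\<upsilon> \<in> UF Y"
  shows "Ulift X Y \<alpha> (\<nu>, \<upsilon>) = klift X \<alpha> \<nu> \<upsilon>"
proof -
  have eq: "Ulift X Y \<alpha> (\<nu>, \<upsilon>) =
      (SUP \<Upsilon>\<in>UF (UF X). (if umult \<Upsilon> = \<nu> then 1 else bot) * Urel (UF X) Y \<alpha> (\<Upsilon>, \<upsilon>))"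
    using \<nu> \<upsilon> by (simp add: Ulift_def rcomp_def converse_rel_def graph_rel_def cong: SUP_cong)
  show ?thesis
  proof (rule order.antisym)
    show "Ulift X Y \<alpha> (\<nu>, \<upsilon>) \<le> klift X \<alpha> \<nu> \<upsilon>"
      unfolding eq by (rule SUP_least) (use \<upsilon> Urel_le_klift in auto)
    show "klift X \<alpha> \<nu> \<upsilon> \<le> Ulift X Y \<alpha> (\<nu>, \<upsilon>)"
      unfolding klift_eq_SUP_xi[OF \<nu> \<upsilon>]
    proof (rule SUP_least, clarify)
      fix \<theta> assume \<theta>: "\<theta> \<in> UF (UF X \<times> Y)" "\<nu> = umult (filtermap fst \<theta>)" "\<upsilon> = filtermap snd \<theta>"
      have "xi (filtermap \<alpha> \<theta>) \<le> Urel (UF X) Y \<alpha> (filtermap fst \<theta>, \<upsilon>)"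
        using xi_le_Urel[OF \<theta>(1)] \<theta>(3) by simp
      moreover have "filtermap fst \<theta> \<in> UF (UF X)" by (auto intro!: UF_filtermap[OF _ \<theta>(1)])
      ultimately have "xi (filtermap \<alpha> \<theta>) \<le> Ulift X Y \<alpha> (\<nu>, \<upsilon>)"
        unfolding eq using \<theta>(2) by (intro SUP_upper2[of "filtermap fst \<theta>"]) auto
      then show "xi (filtermap \<alpha> \<theta>) \<le> Ulift X Y \<alpha> (umult (filtermap fst \<theta>), filtermap snd \<theta>)"
        using \<theta> by simp
    qed
  qed
qed

lemma kconv_eq:
  assumes "\<nu> \<in> UF X" "z \<in> Z"
  shows "kconv X Y Z \<beta> \<alpha> (\<nu>, z) = (SUP \<upsilon>\<in>UF Y. klift X \<alpha> \<nu> \<upsilon> * \<beta> (\<upsilon>, z))"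
  using assms by (simp add: kconv_def rcomp_def Ulift_eq_klift cong: SUP_cong)

lemma kconv_le_iff:
  assumes "\<nu> \<in> UF X" "z \<in> Z"
  shows "kconv X Y Z \<beta> \<alpha> (\<nu>, z) \<le> c \<longleftrightarrow> (\<forall>\<upsilon>\<in>UF Y. klift X \<alpha> \<nu> \<upsilon> * \<beta> (\<upsilon>, z) \<le> c)"
  using assms by (simp add: kconv_eq SUP_le_iff)

lemma kext_eq:
  assumes "\<upsilon> \<in> UF Y" "z \<in> Z"
  shows "kext X Y Z \<gamma> \<alpha> (\<upsilon>, z) = (INF \<nu>\<in>UF X. qhom (klift X \<alpha> \<nu> \<upsilon>) (\<gamma> (\<nu>, z)))"
  using assms by (simp add: kext_def Ulift_eq_klift cong: INF_cong)

section \<open>Distributors and presheaves\<close>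

lemma rel_eqI:
  assumes "r \<in> rel X Y" "r' \<in> rel X Y" "\<And>x y. x \<in> X \<Longrightarrow> y \<in> Y \<Longrightarrow> r (x, y) = r' (x, y)"
  shows "r = r'"
  using assms unfolding rel_def by (intro PiE_ext[of r "X \<times> Y" "\<lambda>_. UNIV" r']) auto

lemma eq_iff_lower: "(a::'q::quantale) = b \<longleftrightarrow> (\<forall>c. c \<le> b \<longleftrightarrow> c \<le> a)"
  by (meson order.antisym order.refl)

lemma kconv_in_rel: "kconv X Y Z \<beta> \<alpha> \<in> rel (UF X) Z"
  by (auto simp: kconv_def rcomp_def rel_def)

lemma kext_in_rel: "kext X Y Z \<gamma> \<alpha> \<in> rel (UF Y) Z"
  by (auto simp: kext_def rel_def)

lemma lower_star_in_rel: "lower_star X Y f \<in> rel (UF (obj X)) (obj Y)"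
  by (auto simp: lower_star_def rel_def)

lemma le_kext_iff:
  assumes "\<upsilon> \<in> UF Y" "z \<in> Z"
  shows "c \<le> kext X Y Z \<gamma> \<alpha> (\<upsilon>, z) \<longleftrightarrow> (\<forall>\<nu>\<in>UF X. klift X \<alpha> \<nu> \<upsilon> * c \<le> \<gamma> (\<nu>, z))"
  using assms by (simp add: kext_eq le_INF_iff le_qhom_iff)

lemma arr_refl: "is_ucat X \<Longrightarrow> x \<in> obj X \<Longrightarrow> 1 \<le> arr X (pt x, x)"
  by (simp add: is_ucat_def)

lemma mult_one_le: "1 \<le> b \<Longrightarrow> (a::'q::quantale) \<le> a * b"
  using quantale_mult_mono[of a a 1 b] by simp

lemma le_kconv_arr_left:
  assumes "is_ucat Y" "\<nu> \<in> UF X" "y \<in> obj Y"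
  shows "\<phi> (\<nu>, y) \<le> kconv X (obj Y) (obj Y) (arr Y) \<phi> (\<nu>, y)"
proof -
  have "\<phi> (\<nu>, y) \<le> klift X \<phi> \<nu> (pt y) * arr Y (pt y, y)"
    using le_klift_pt[OF assms(2)] mult_one_le[OF arr_refl[OF assms(1,3)]] by (rule order.trans)
  then show ?thesis
    using assms UF_pt[OF assms(3)] by (auto simp: kconv_eq intro: SUP_upper2)
qed

lemma le_kconv_arr_right:
  assumes "is_ucat X" "\<nu> \<in> UF (obj X)" "y \<in> Y"
  shows "\<phi> (\<nu>, y) \<le> kconv (obj X) (obj X) Y \<phi> (arr X) (\<nu>, y)"
proof -
  have "1 \<le> klift (obj X) (arr X) \<nu> \<nu>" using assms by (intro one_le_klift_refl arr_refl)
  from mult_one_le[OF this, of "\<phi> (\<nu>, y)"] show ?thesis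
    using assms by (auto simp: kconv_eq mult.commute intro: SUP_upper2)
qed

text \<open>Reflexivity of the two categories gives one inequality in each defining equation, so
  only the action inequalities remain, separated over the middle ultrafilter.\<close>

lemma is_distributor_iff:
  assumes X: "is_ucat X" and Y: "is_ucat Y"
  shows "is_distributor X Y \<phi> \<longleftrightarrow> \<phi> \<in> rel (UF (obj X)) (obj Y) \<and>
    (\<forall>\<nu>\<in>UF (obj X). \<forall>y\<in>obj Y.
      (\<forall>\<sigma>\<in>UF (obj X). klift (obj X) (arr X) \<nu> \<sigma> * \<phi> (\<sigma>, y) \<le> \<phi> (\<nu>, y)) \<and>
      (\<forall>\<upsilon>\<in>UF (obj Y). klift (obj X) \<phi> \<nu> \<upsilon> * arr Y (\<upsilon>, y) \<le> \<phi> (\<nu>, y)))"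
proof -
  have eq_iff: "r = r' \<longleftrightarrow> (\<forall>\<nu>\<in>UF (obj X). \<forall>y\<in>obj Y. r (\<nu>, y) \<le> r' (\<nu>, y))"
    if "r \<in> rel (UF (obj X)) (obj Y)" "r' \<in> rel (UF (obj X)) (obj Y)"
      "\<And>\<nu> y. \<nu> \<in> UF (obj X) \<Longrightarrow> y \<in> obj Y \<Longrightarrow> r' (\<nu>, y) \<le> r (\<nu>, y)" for r r' :: "'a filter \<times> 'c \<Rightarrow> 'b"
    using that rel_eqI[of r "UF (obj X)" "obj Y" r'] by (fastforce intro: order.antisym)
  show ?thesis
  proof (cases "\<phi> \<in> rel (UF (obj X)) (obj Y)")
    case True
    have "kconv (obj X) (obj X) (obj Y) \<phi> (arr X) = \<phi> \<longleftrightarrow>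
      (\<forall>\<nu>\<in>UF (obj X). \<forall>y\<in>obj Y. \<forall>\<sigma>\<in>UF (obj X). klift (obj X) (arr X) \<nu> \<sigma> * \<phi> (\<sigma>, y) \<le> \<phi> (\<nu>, y))"
      by (subst eq_iff[OF kconv_in_rel True le_kconv_arr_right[OF X]]) (simp_all add: kconv_le_iff)
    moreover have "kconv (obj X) (obj Y) (obj Y) (arr Y) \<phi> = \<phi> \<longleftrightarrow>
      (\<forall>\<nu>\<in>UF (obj X). \<forall>y\<in>obj Y. \<forall>\<upsilon>\<in>UF (obj Y). klift (obj X) \<phi> \<nu> \<upsilon> * arr Y (\<upsilon>, y) \<le> \<phi> (\<nu>, y))"
      by (subst eq_iff[OF kconv_in_rel True le_kconv_arr_left[OF Y]]) (simp_all add: kconv_le_iff)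
    ultimately show ?thesis using True by (auto simp: is_distributor_def)
  qed (simp add: is_distributor_def)
qed

text \<open>The nontrivial inequality is the action of \<open>Y\<close> at \<open>pt y\<close>,
  where reflexivity makes the factor \<open>arr Y (pt y, y)\<close> at least 1.\<close>

lemma klift_distributor_pt:
  assumes X: "is_ucat X" and Y: "is_ucat Y" and \<phi>: "is_distributor X Y \<phi>"
    and \<nu>: "\<nu> \<in> UF (obj X)" and y: "y \<in> obj Y"
  shows "klift (obj X) \<phi> \<nu> (pt y) = \<phi> (\<nu>, y)"
proof (rule order.antisym)
  have "klift (obj X) \<phi> \<nu> (pt y) \<le> klift (obj X) \<phi> \<nu> (pt y) * arr Y (pt y, y)"
    by (rule mult_one_le[OF arr_refl[OF Y y]])
  also have "\<dots> \<le> \<phi> (\<nu>, y)" using \<phi> \<nu> y UF_pt[OF y] by (auto simp: is_distributor_iff[OF X Y])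
  finally show "klift (obj X) \<phi> \<nu> (pt y) \<le> \<phi> (\<nu>, y)" .
qed (rule le_klift_pt[OF \<nu>])

lemma obj_one_cat [simp]: "obj (one_cat s) = {s}"
  by (simp add: one_cat_def)

lemma arr_one_cat [simp]: "arr (one_cat s) (pt s, s) = 1"
  by (simp add: one_cat_def converse_rel_def graph_rel_def UF_singleton)

lemma is_ucat_one_cat: "is_ucat (one_cat s)"
proof -
  have "arr (one_cat s) \<in> rel (UF {s}) {s}"
    by (auto simp: one_cat_def converse_rel_def rel_def)
  then show ?thesis
    using UF_umult[of _ "{s}"] by (auto simp: is_ucat_def UF_singleton quantale_le_one)
qed

lemma is_functor_const:
  assumes "is_ucat X" "x \<in> obj X"
  shows "is_functor (one_cat s) X (\<lambda>_. x)"
  using assms by (auto simp: is_functor_def UF_singleton filtermap_principal arr_refl)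

lemma point_upper_eq:
  "\<upsilon> \<in> UF (obj X) \<Longrightarrow> point_upper s X x (\<upsilon>, s) = arr X (\<upsilon>, x)"
  by (simp add: point_upper_def upper_star_def)

text \<open>\<open>point_upper\<close> is the column of \<open>arr Y\<close> at \<open>y\<close>, so
  this is one column of the identity that \<open>arr Y\<close> composed with \<phi> is
  \<phi>.\<close>

lemma kconv_point_upper:
  assumes \<phi>: "is_distributor X Y \<phi>" and y: "y \<in> obj Y"
  shows "kconv (obj X) (obj Y) {s} (point_upper s Y y) \<phi> = (\<lambda>(\<sigma>, z)\<in>UF (obj X) \<times> {s}. \<phi> (\<sigma>, y))"
proof (rule rel_eqI[OF kconv_in_rel])
  fix \<nu> z assume \<nu>: "\<nu> \<in> UF (obj X)" and z: "z \<in> {s}"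
  have "kconv (obj X) (obj Y) {s} (point_upper s Y y) \<phi> (\<nu>, z) =
      kconv (obj X) (obj Y) (obj Y) (arr Y) \<phi> (\<nu>, y)"
    using \<nu> y z by (simp add: kconv_eq point_upper_eq cong: SUP_cong)
  also have "\<dots> = \<phi> (\<nu>, y)" using \<phi> by (simp add: is_distributor_def)
  finally show "kconv (obj X) (obj Y) {s} (point_upper s Y y) \<phi> (\<nu>, z) =
      (\<lambda>(\<sigma>, z)\<in>UF (obj X) \<times> {s}. \<phi> (\<sigma>, y)) (\<nu>, z)" using \<nu> z by simp
qed (auto simp: rel_def)

text \<open>The one-point category has the single ultrafilter \<open>pt s\<close>, with structure
  value 1, so its action reduces to one lift.\<close>

lemma is_distributor_to_one_iff:
  assumes X: "is_ucat X"
  shows "is_distributor X (one_cat s) (to_one s X \<psi>) \<longleftrightarrow>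
    (\<forall>\<nu>\<in>UF (obj X).
      (\<forall>\<sigma>\<in>UF (obj X). klift (obj X) (arr X) \<nu> \<sigma> * \<psi> \<sigma> \<le> \<psi> \<nu>) \<and>
      klift (obj X) (to_one s X \<psi>) \<nu> (pt s) \<le> \<psi> \<nu>)"
proof -
  have "to_one s X \<psi> \<in> rel (UF (obj X)) {s}" by (auto simp: to_one_def rel_def)
  then show ?thesis
    by (simp add: is_distributor_iff[OF X is_ucat_one_cat] UF_singleton) (simp add: to_one_def)
qed

text \<open>The functoriality condition in \<^const>\<open>power_obj\<close> is implied by being a distributor.\<close>

lemma distributor_in_power_obj:
  assumes X: "is_ucat X" and \<psi>: "\<psi> \<in> UF (obj X) \<rightarrow>\<^sub>E UNIV"
    and dist: "is_distributor X (one_cat s) (to_one s X \<psi>)"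
  shows "\<psi> \<in> power_obj X"
proof -
  have "xi (filtermap \<psi> \<Upsilon>) \<le> \<psi> (umult \<Upsilon>)" if \<Upsilon>: "\<Upsilon> \<in> UF (UF (obj X))" for \<Upsilon>
  proof -
    \<comment> \<open>Pairing with the point \<open>s\<close> turns \<Upsilon> into an ultrafilter
      over \<Upsilon> and \<open>pt s\<close>, so that \<open>xi_le_klift\<close> bounds its
      \<xi>-value.\<close>
    define \<theta> where "\<theta> = filtermap (\<lambda>\<sigma>. (\<sigma>, s)) \<Upsilon>"
    have \<theta>: "\<theta> \<in> UF (UF (obj X) \<times> {s})" unfolding \<theta>_def by (rule UF_filtermap[OF _ \<Upsilon>]) auto
    have fst: "filtermap fst \<theta> = \<Upsilon>" by (simp add: \<theta>_def filtermap_filtermap)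
    have "filtermap snd \<theta> \<in> UF {s}" using \<theta> by (rule UF_filtermap[rotated]) auto
    then have snd: "filtermap snd \<theta> = pt s" by (simp add: UF_singleton)
    have "eventually (\<lambda>\<sigma>. \<psi> \<sigma> = to_one s X \<psi> (\<sigma>, s)) \<Upsilon>"
      using UF_D(2)[OF \<Upsilon>] by eventually_elim (simp add: to_one_def)
    then have "filtermap \<psi> \<Upsilon> = filtermap (to_one s X \<psi>) \<theta>"
      unfolding \<theta>_def filtermap_filtermap filter_eq_iff eventually_filtermap
      by (auto elim: eventually_elim2)
    then have "xi (filtermap \<psi> \<Upsilon>) \<le> klift (obj X) (to_one s X \<psi>) (umult \<Upsilon>) (pt s)"
      using xi_le_klift[OF \<theta>, of "to_one s X \<psi>"] by (simp add: fst snd)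
    also have "\<dots> \<le> \<psi> (umult \<Upsilon>)"
      using dist UF_umult[OF \<Upsilon>] by (simp add: is_distributor_to_one_iff[OF X])
    finally show ?thesis .
  qed
  then have "is_functor (free_cat X) quantale_cat \<psi>"
    using UF_filtermap[of \<psi> "UF (obj X)" UNIV]
    by (auto simp: is_functor_def free_cat_def quantale_cat_def graph_rel_def le_qhom_iff)
  with \<psi> show ?thesis by (simp add: power_obj_def)
qed

abbreviation eval_rel :: "'a filter \<times> ('a filter \<Rightarrow> 'q) \<Rightarrow> 'q" where
  "eval_rel \<equiv> \<lambda>(\<sigma>, \<psi>). \<psi> \<sigma>"

text \<open>Group the ultrafilters \<theta> by \<nu> =
  \<open>umult (filtermap fst \<theta>)\<close>; within a group, \<open>qhom_SUP\<close> turns the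
  infimum of residuals into the residual of a supremum, which is the lifting.\<close>

lemma power_arr_eq:
  assumes \<rho>: "\<rho> \<in> UF (power_obj X)" and \<psi>: "\<psi> \<in> power_obj X"
  shows "arr (power_cat X) (\<rho>, \<psi>) = (INF \<nu>\<in>UF (obj X). qhom (klift (obj X) eval_rel \<nu> \<rho>) (\<psi> \<nu>))"
proof -
  let ?\<Theta> = "{\<theta> \<in> UF (UF (obj X) \<times> power_obj X). filtermap snd \<theta> = \<rho>}"
  let ?q = "\<lambda>\<theta>. qhom (xi (filtermap eval_rel \<theta>)) (\<psi> (umult (filtermap fst \<theta>)))"
  have "(INF \<nu>\<in>UF (obj X). qhom (klift (obj X) eval_rel \<nu> \<rho>) (\<psi> \<nu>)) =
      (INF \<nu>\<in>UF (obj X). INF \<theta>\<in>{\<theta> \<in> ?\<Theta>. umult (filtermap fst \<theta>) = \<nu>}. ?q \<theta>)"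
    by (intro INF_cong refl) (auto simp: klift_eq_SUP_xi[OF _ \<rho>] qhom_SUP conj_ac intro!: INF_cong)
  also have "\<dots> = (INF \<theta>\<in>?\<Theta>. ?q \<theta>)"
  proof (rule order.antisym)
    show "(INF \<nu>\<in>UF (obj X). INF \<theta>\<in>{\<theta> \<in> ?\<Theta>. umult (filtermap fst \<theta>) = \<nu>}. ?q \<theta>) \<le> (INF \<theta>\<in>?\<Theta>. ?q \<theta>)"
    proof (rule INF_greatest)
      fix \<theta> assume \<theta>: "\<theta> \<in> ?\<Theta>"
      then have "umult (filtermap fst \<theta>) \<in> UF (obj X)"
        by (intro UF_umult UF_filtermap[of fst "UF (obj X) \<times> power_obj X"]) auto
      then show "(INF \<nu>\<in>UF (obj X). INF \<theta>\<in>{\<theta> \<in> ?\<Theta>. umult (filtermap fst \<theta>) = \<nu>}. ?q \<theta>) \<le> ?q \<theta>"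
        by (rule INF_lower2) (use \<theta> in \<open>auto intro!: INF_lower\<close>)
    qed
    show "(INF \<theta>\<in>?\<Theta>. ?q \<theta>) \<le> (INF \<nu>\<in>UF (obj X). INF \<theta>\<in>{\<theta> \<in> ?\<Theta>. umult (filtermap fst \<theta>) = \<nu>}. ?q \<theta>)"
      by (intro INF_greatest INF_lower) auto
  qed
  also have "\<dots> = arr (power_cat X) (\<rho>, \<psi>)" using \<rho> \<psi> by (simp add: power_cat_def)
  finally show ?thesis ..
qed

section \<open>The category \<open>JX\<close> of presheaves in \<open>J\<close>\<close>

locale J_cocomplete_cat =
  fixes s :: 'u and J :: "('u, 'q::quantale) dist_class" and X :: "('u, 'q) ucat"
    and S :: "('u filter \<Rightarrow> 'q) \<Rightarrow> 'u"
  assumes J: "is_dist_class s J" and X: "is_ucat X" and cocomplete: "J_cocomplete s J X S"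
begin

abbreviation "Ob \<equiv> obj X"
abbreviation "hom \<equiv> arr X"
abbreviation "JX \<equiv> J_cat s J X"

lemma J_distributor: "is_ucat A \<Longrightarrow> is_ucat B \<Longrightarrow> \<phi> \<in> J A B \<Longrightarrow> is_distributor A B \<phi>"
  using J unfolding is_dist_class_def by blast

lemma J_kconv:
  "is_ucat A \<Longrightarrow> is_ucat B \<Longrightarrow> is_ucat C \<Longrightarrow> \<phi> \<in> J A B \<Longrightarrow> \<psi> \<in> J B C \<Longrightarrow>
    kconv (obj A) (obj B) (obj C) \<psi> \<phi> \<in> J A C"
  using J unfolding is_dist_class_def by blast

lemma J_upper_star: "is_ucat A \<Longrightarrow> is_ucat B \<Longrightarrow> is_functor A B f \<Longrightarrow> upper_star A B f \<in> J B A"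
  using J unfolding is_dist_class_def by blast

lemma J_pointwise:
  assumes "is_ucat A" "is_ucat B" "is_distributor A B \<phi>"
    and "\<And>y. y \<in> obj B \<Longrightarrow> kconv (obj A) (obj B) {s} (point_upper s B y) \<phi> \<in> J A (one_cat s)"
  shows "\<phi> \<in> J A B"
  using J assms unfolding is_dist_class_def by blast

lemma JX_obj_iff: "\<psi> \<in> obj JX \<longleftrightarrow> \<psi> \<in> UF Ob \<rightarrow>\<^sub>E UNIV \<and> to_one s X \<psi> \<in> J X (one_cat s)"
  using J_distributor[OF X is_ucat_one_cat] distributor_in_power_obj[OF X, of \<psi> s]
  by (auto simp: J_cat_def presheaf_cat_def full_sub_def power_obj_def)

lemma JX_distributor: "\<psi> \<in> obj JX \<Longrightarrow> is_distributor X (one_cat s) (to_one s X \<psi>)"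
  using J_distributor[OF X is_ucat_one_cat] by (simp add: JX_obj_iff)

lemma JX_power: "\<psi> \<in> obj JX \<Longrightarrow> \<psi> \<in> power_obj X"
  using distributor_in_power_obj[OF X] JX_distributor JX_obj_iff by blast

lemma JX_hom_mult:
  "\<psi> \<in> obj JX \<Longrightarrow> \<nu> \<in> UF Ob \<Longrightarrow> \<sigma> \<in> UF Ob \<Longrightarrow> klift Ob hom \<nu> \<sigma> * \<psi> \<sigma> \<le> \<psi> \<nu>"
  using JX_distributor by (simp add: is_distributor_to_one_iff[OF X])

text \<open>The structure is unchanged in both full subcategories, so \<open>power_arr_eq\<close>
  applies once \<rho> is viewed as an ultrafilter on the larger object sets.\<close>

lemma le_JX_arr_iff:
  assumes \<rho>: "\<rho> \<in> UF (obj JX)" and \<psi>: "\<psi> \<in> obj JX"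
  shows "c \<le> arr JX (\<rho>, \<psi>) \<longleftrightarrow> (\<forall>\<nu>\<in>UF Ob. klift Ob eval_rel \<nu> \<rho> * c \<le> \<psi> \<nu>)"
proof -
  have "\<rho> \<in> UF (power_obj X)"
    using \<rho> by (rule UF_mono) (use UF_D(2)[OF \<rho>] JX_power in \<open>auto elim: eventually_mono\<close>)
  moreover have "arr JX (\<rho>, \<psi>) = arr (presheaf_cat s X) (\<rho>, \<psi>)"
    using \<rho> \<psi> by (simp add: J_cat_def full_sub_def)
  moreover have "\<psi> \<in> obj (presheaf_cat s X)"
    using \<psi> by (simp add: J_cat_def full_sub_def)
  moreover have "\<rho> \<in> UF (obj (presheaf_cat s X))"
    using \<rho> by (rule UF_mono) (use UF_D(2)[OF \<rho>] in \<open>auto simp: J_cat_def full_sub_def elim: eventually_mono\<close>)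
  ultimately show ?thesis
    using power_arr_eq[of \<rho> X \<psi>] JX_power[OF \<psi>]
    by (simp add: presheaf_cat_def full_sub_def le_INF_iff le_qhom_iff)
qed

text \<open>\<open>pt \<chi>\<close> is the image of \<open>pt s\<close> under a constant map, which
  reduces evaluation to the distributor \<open>to_one s X \<chi>\<close>.\<close>

lemma klift_eval_pt:
  assumes \<chi>: "\<chi> \<in> obj JX" and \<nu>: "\<nu> \<in> UF Ob"
  shows "klift Ob eval_rel \<nu> (pt \<chi>) = \<chi> \<nu>"
proof -
  have "klift Ob eval_rel \<nu> (pt \<chi>) = klift Ob eval_rel \<nu> (filtermap (\<lambda>_. \<chi>) (pt s))"
    by (simp add: filtermap_principal)
  also have "\<dots> = klift Ob (to_one s X \<chi>) \<nu> (pt s)"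
    unfolding klift_filtermap by (rule klift_cong[OF UF_pt[of s "{s}"]]) (auto simp: to_one_def)
  also have "\<dots> = to_one s X \<chi> (\<nu>, s)"
    using klift_distributor_pt[OF X is_ucat_one_cat JX_distributor[OF \<chi>] \<nu>] by simp
  finally show ?thesis using \<nu> by (simp add: to_one_def)
qed

lemma le_JX_arr_pt_iff:
  assumes "\<chi> \<in> obj JX" "\<psi> \<in> obj JX"
  shows "c \<le> arr JX (pt \<chi>, \<psi>) \<longleftrightarrow> (\<forall>\<nu>\<in>UF Ob. \<chi> \<nu> * c \<le> \<psi> \<nu>)"
  using assms by (simp add: le_JX_arr_iff UF_pt klift_eval_pt)

text \<open>By residuation, evaluation followed by \<open>arr JX\<close> stays below evaluation;
  \<open>klift_compose\<close> transfers this to lifts, and a second use at \<psi> gives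
  transitivity.\<close>

lemma is_ucat_JX: "is_ucat JX"
  unfolding is_ucat_def
proof (intro conjI ballI)
  show "arr JX \<in> rel (UF (obj JX)) (obj JX)" by (auto simp: J_cat_def full_sub_def rel_def)
  show "1 \<le> arr JX (pt \<psi>, \<psi>)" if "\<psi> \<in> obj JX" for \<psi> using that by (simp add: le_JX_arr_pt_iff)
  fix \<Upsilon> \<rho> \<psi> assume \<Upsilon>: "\<Upsilon> \<in> UF (UF (obj JX))" and \<rho>: "\<rho> \<in> UF (obj JX)" and \<psi>: "\<psi> \<in> obj JX"
  show "Urel (UF (obj JX)) (obj JX) (arr JX) (\<Upsilon>, \<rho>) * arr JX (\<rho>, \<psi>) \<le> arr JX (umult \<Upsilon>, \<psi>)"
    unfolding le_JX_arr_iff[OF UF_umult[OF \<Upsilon>] \<psi>]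
  proof
    fix \<nu> assume \<nu>: "\<nu> \<in> UF Ob"
    have "klift Ob eval_rel \<nu> (umult \<Upsilon>) * Urel (UF (obj JX)) (obj JX) (arr JX) (\<Upsilon>, \<rho>)
        \<le> klift Ob eval_rel \<nu> (umult \<Upsilon>) * klift (obj JX) (arr JX) (umult \<Upsilon>) \<rho>"
      by (intro quantale_mult_mono Urel_le_klift[OF \<Upsilon> \<rho>] order.refl)
    also have "\<dots> \<le> klift Ob eval_rel \<nu> \<rho>"
      using \<nu> UF_umult[OF \<Upsilon>] \<rho>
    proof (rule klift_compose)
      fix \<sigma> \<rho>' \<chi> assume "\<sigma> \<in> UF Ob" "\<rho>' \<in> UF (obj JX)" "\<chi> \<in> obj JX"
      then show "klift Ob eval_rel \<sigma> \<rho>' * arr JX (\<rho>', \<chi>) \<le> eval_rel (\<sigma>, \<chi>)"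
        using le_JX_arr_iff[of \<rho>' \<chi> "arr JX (\<rho>', \<chi>)"] by simp
    qed
    finally have "klift Ob eval_rel \<nu> (umult \<Upsilon>) * Urel (UF (obj JX)) (obj JX) (arr JX) (\<Upsilon>, \<rho>) * arr JX (\<rho>, \<psi>)
        \<le> klift Ob eval_rel \<nu> \<rho> * arr JX (\<rho>, \<psi>)"
      by (intro quantale_mult_mono order.refl)
    also have "\<dots> \<le> \<psi> \<nu>" using le_JX_arr_iff[OF \<rho> \<psi>, of "arr JX (\<rho>, \<psi>)"] \<nu> by simp
    finally show "klift Ob eval_rel \<nu> (umult \<Upsilon>) *
        (Urel (UF (obj JX)) (obj JX) (arr JX) (\<Upsilon>, \<rho>) * arr JX (\<rho>, \<psi>)) \<le> \<psi> \<nu>"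
      by (simp add: mult.assoc)
  qed
qed

text \<open>Translates between a presheaf-valued map \<open>f\<close> and its transpose \<phi>; it
  serves for \<open>yoneda X\<close> with \<open>hom\<close> and for \<open>t\<close> with its
  distributor.\<close>

lemma le_JX_arr_filtermap_iff:
  assumes f: "f \<in> Y \<rightarrow> obj JX" and \<upsilon>: "\<upsilon> \<in> UF Y" and \<psi>: "\<psi> \<in> obj JX"
    and \<phi>: "\<And>\<sigma> y. \<sigma> \<in> UF Ob \<Longrightarrow> y \<in> Y \<Longrightarrow> \<phi> (\<sigma>, y) = f y \<sigma>"
  shows "c \<le> arr JX (filtermap f \<upsilon>, \<psi>) \<longleftrightarrow> (\<forall>\<nu>\<in>UF Ob. klift Ob \<phi> \<nu> \<upsilon> * c \<le> \<psi> \<nu>)"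
proof -
  have "klift Ob eval_rel \<nu> (filtermap f \<upsilon>) = klift Ob \<phi> \<nu> \<upsilon>" for \<nu>
    unfolding klift_filtermap by (rule klift_cong[OF \<upsilon>]) (simp add: \<phi>)
  then show ?thesis using le_JX_arr_iff[OF UF_filtermap[OF f \<upsilon>] \<psi>] by simp
qed

section \<open>Suprema and the Yoneda lemma\<close>

lemma S_functor: "is_functor JX X S"
  and yoneda_functor: "is_functor X JX (yoneda X)"
  using cocomplete by (simp_all add: J_cocomplete_def adjoint_def)

lemma S_obj: "\<psi> \<in> obj JX \<Longrightarrow> S \<psi> \<in> Ob"
  and yoneda_obj: "x \<in> Ob \<Longrightarrow> yoneda X x \<in> obj JX"
  using S_functor yoneda_functor by (auto simp: is_functor_def)

lemma hom_S: "\<rho> \<in> UF (obj JX) \<Longrightarrow> x \<in> Ob \<Longrightarrow> hom (filtermap S \<rho>, x) = arr JX (\<rho>, yoneda X x)"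
  using cocomplete adjoint_iff[OF is_ucat_JX X S_functor yoneda_functor]
  by (simp add: J_cocomplete_def)

text \<open>The adjunction at a principal ultrafilter: the universal property of
  \<open>S \<psi>\<close> as the supremum weighted by \<psi>.\<close>

lemma le_hom_S_pt_iff:
  assumes "\<psi> \<in> obj JX" "x \<in> Ob"
  shows "c \<le> hom (pt (S \<psi>), x) \<longleftrightarrow> (\<forall>\<nu>\<in>UF Ob. \<psi> \<nu> * c \<le> hom (\<nu>, x))"
  using assms hom_S[OF UF_pt[OF assms(1)] assms(2)]
  by (simp add: filtermap_principal le_JX_arr_pt_iff yoneda_obj) (simp add: yoneda_def)

lemma le_hom_S:
  assumes "\<psi> \<in> obj JX" "\<nu> \<in> UF Ob"
  shows "\<psi> \<nu> \<le> hom (\<nu>, S \<psi>)"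
  using le_hom_S_pt_iff[OF assms(1) S_obj[OF assms(1)], of 1] arr_refl[OF X S_obj[OF assms(1)]] assms(2)
  by simp

text \<open>One inequality is the action of \<open>hom\<close> on \<psi>; for the other, the test at
  \<nu> = \<sigma> suffices because the lift of \<open>hom\<close> is reflexive.\<close>

lemma yoneda_lemma:
  assumes \<sigma>: "\<sigma> \<in> UF Ob" and \<psi>: "\<psi> \<in> obj JX"
  shows "arr JX (filtermap (yoneda X) \<sigma>, \<psi>) = \<psi> \<sigma>"
proof (rule order.antisym)
  have iff: "c \<le> arr JX (filtermap (yoneda X) \<sigma>, \<psi>) \<longleftrightarrow> (\<forall>\<nu>\<in>UF Ob. klift Ob hom \<nu> \<sigma> * c \<le> \<psi> \<nu>)" for c
    by (rule le_JX_arr_filtermap_iff[OF _ \<sigma> \<psi>]) (auto simp: yoneda_obj, simp add: yoneda_def)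
  show "\<psi> \<sigma> \<le> arr JX (filtermap (yoneda X) \<sigma>, \<psi>)"
    unfolding iff using JX_hom_mult[OF \<psi> _ \<sigma>] by blast
  let ?a = "arr JX (filtermap (yoneda X) \<sigma>, \<psi>)"
  have "1 \<le> klift Ob hom \<sigma> \<sigma>" using \<sigma> X by (intro one_le_klift_refl arr_refl)
  then have "?a \<le> klift Ob hom \<sigma> \<sigma> * ?a" using mult_one_le by (metis mult.commute)
  also have "\<dots> \<le> \<psi> \<sigma>" using iff[of ?a] \<sigma> by blast
  finally show "?a \<le> \<psi> \<sigma>" .
qed

lemma lower_star_yoneda:
  "\<sigma> \<in> UF Ob \<Longrightarrow> \<psi> \<in> obj JX \<Longrightarrow> lower_star X JX (yoneda X) (\<sigma>, \<psi>) = \<psi> \<sigma>"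
  by (simp add: lower_star_def yoneda_lemma)

text \<open>The entries of the upper star of \<open>S\<close> at \<psi> form the column of
  \<open>hom\<close> at \<open>S \<psi>\<close>, and \<gamma> absorbs \<open>hom\<close>.\<close>

lemma kconv_upper_star_S:
  assumes \<gamma>: "is_distributor X X \<gamma>" and \<nu>: "\<nu> \<in> UF Ob" and \<psi>: "\<psi> \<in> obj JX"
  shows "kconv Ob Ob (obj JX) (upper_star JX X S) \<gamma> (\<nu>, \<psi>) = \<gamma> (\<nu>, S \<psi>)"
proof -
  have "kconv Ob Ob (obj JX) (upper_star JX X S) \<gamma> (\<nu>, \<psi>) = kconv Ob Ob Ob hom \<gamma> (\<nu>, S \<psi>)"
    using \<nu> \<psi> S_obj[OF \<psi>] by (simp add: kconv_eq upper_star_def cong: SUP_cong)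
  then show ?thesis using \<gamma> by (simp add: is_distributor_def)
qed

lemma kconv_lower_star_yoneda:
  assumes \<nu>: "\<nu> \<in> UF Ob" and \<psi>: "\<psi> \<in> obj JX"
  shows "kconv Ob Ob (obj JX) (lower_star X JX (yoneda X)) \<gamma> (\<nu>, \<psi>) =
    (SUP \<upsilon>\<in>UF Ob. klift Ob \<gamma> \<nu> \<upsilon> * \<psi> \<upsilon>)"
  using \<nu> \<psi> by (simp add: kconv_eq lower_star_yoneda cong: SUP_cong)

section \<open>Pointwise forms of the conditions on distributors\<close>

lemma is_way_below_iff:
  "is_way_below s J X S w \<longleftrightarrow> is_distributor X X w \<and>
    (\<forall>\<gamma>. is_distributor X X \<gamma> \<longrightarrow>
      ((\<forall>\<nu>\<in>UF Ob. \<forall>\<psi>\<in>obj JX. \<gamma> (\<nu>, S \<psi>) \<le> \<psi> \<nu>) \<longleftrightarrow> rel_le (UF Ob) Ob \<gamma> w))"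
  unfolding is_way_below_def
  by (auto simp: rel_le_def kconv_upper_star_S lower_star_yoneda)

lemma is_J_cocontinuous_iff:
  "is_J_cocontinuous s J X S v \<longleftrightarrow> is_distributor X X v \<and>
    (\<forall>\<nu>\<in>UF Ob. \<forall>\<psi>\<in>obj JX. v (\<nu>, S \<psi>) = (SUP \<upsilon>\<in>UF Ob. klift Ob v \<nu> \<upsilon> * \<psi> \<upsilon>))"
proof (cases "is_distributor X X v")
  case True
  have "kconv Ob Ob (obj JX) (upper_star JX X S) v = kconv Ob Ob (obj JX) (lower_star X JX (yoneda X)) v \<longleftrightarrow>
      (\<forall>\<nu>\<in>UF Ob. \<forall>\<psi>\<in>obj JX. kconv Ob Ob (obj JX) (upper_star JX X S) v (\<nu>, \<psi>) =
        kconv Ob Ob (obj JX) (lower_star X JX (yoneda X)) v (\<nu>, \<psi>))"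
    by (metis rel_eqI kconv_in_rel)
  with True show ?thesis
    by (simp add: is_J_cocontinuous_def kconv_upper_star_S kconv_lower_star_yoneda)
qed (simp add: is_J_cocontinuous_def)

lemma kconv_point_upper_to_one:
  assumes "is_distributor X X v" "x \<in> Ob"
  shows "kconv Ob Ob {s} (point_upper s X x) v = to_one s X (\<lambda>\<sigma>\<in>UF Ob. v (\<sigma>, x))"
  unfolding kconv_point_upper[OF assms] by (auto simp: to_one_def)

text \<open>The column is the convolution of \<open>v\<close> with \<open>point_upper s X x\<close>,
  which is in \<open>J\<close> as the upper star of a constant functor.\<close>

lemma J_slice:
  assumes v: "v \<in> J X X" and x: "x \<in> Ob"
  shows "(\<lambda>\<sigma>\<in>UF Ob. v (\<sigma>, x)) \<in> obj JX"
proof -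
  have "point_upper s X x \<in> J X (one_cat s)"
    unfolding point_upper_def using X x by (intro J_upper_star is_ucat_one_cat is_functor_const)
  then have "kconv Ob Ob {s} (point_upper s X x) v \<in> J X (one_cat s)"
    using J_kconv[OF X X is_ucat_one_cat v] by simp
  then show ?thesis
    using kconv_point_upper_to_one[OF J_distributor[OF X X v] x] by (simp add: JX_obj_iff)
qed

lemma is_approximating_at_iff:
  assumes x: "x \<in> Ob"
  shows "is_approximating_at s J X v x \<longleftrightarrow> is_distributor X X v \<and> v \<in> J X X \<and>
    (\<forall>z\<in>Ob. \<forall>c. c \<le> hom (pt x, z) \<longleftrightarrow> (\<forall>\<nu>\<in>UF Ob. v (\<nu>, x) * c \<le> hom (\<nu>, z)))"
proof (cases "is_distributor X X v \<and> v \<in> J X X")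
  case True
  define v\<^sub>x where "v\<^sub>x = to_one s X (\<lambda>\<sigma>\<in>UF Ob. v (\<sigma>, x))"
  \<comment> \<open>On the one-point category the lift of \<open>v\<^sub>x\<close> at
    \<open>pt s\<close> collapses to the column of \<open>v\<close> at \<open>x\<close>.\<close>
  have vx: "klift Ob v\<^sub>x \<nu> (pt s) = v (\<nu>, x)" if "\<nu> \<in> UF Ob" for \<nu>
    unfolding v\<^sub>x_def
    using klift_distributor_pt[OF X is_ucat_one_cat JX_distributor[OF J_slice] that] True x that
    by (simp add: to_one_def)
  have "kext Ob {s} Ob hom v\<^sub>x = point_lower s X x \<longleftrightarrow>
      (\<forall>\<upsilon>\<in>UF {s}. \<forall>z\<in>Ob. kext Ob {s} Ob hom v\<^sub>x (\<upsilon>, z) = point_lower s X x (\<upsilon>, z))"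
    using rel_eqI[OF kext_in_rel lower_star_in_rel[of "one_cat s" X "\<lambda>_. x", simplified]]
    unfolding point_lower_def by metis
  also have "\<dots> \<longleftrightarrow> (\<forall>z\<in>Ob. kext Ob {s} Ob hom v\<^sub>x (pt s, z) = hom (pt x, z))"
    by (simp add: UF_singleton point_lower_def lower_star_def filtermap_principal)
  also have "\<dots> \<longleftrightarrow> (\<forall>z\<in>Ob. \<forall>c. c \<le> hom (pt x, z) \<longleftrightarrow> c \<le> kext Ob {s} Ob hom v\<^sub>x (pt s, z))"
    by (simp only: eq_iff_lower)
  also have "\<dots> \<longleftrightarrow> (\<forall>z\<in>Ob. \<forall>c. c \<le> hom (pt x, z) \<longleftrightarrow> (\<forall>\<nu>\<in>UF Ob. v (\<nu>, x) * c \<le> hom (\<nu>, z)))"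
    by (simp add: le_kext_iff UF_singleton vx)
  finally show ?thesis
    using True x by (simp add: is_approximating_at_def kconv_point_upper_to_one v\<^sub>x_def)
qed (auto simp: is_approximating_at_def)

lemma is_approximating_iff:
  "is_approximating J X v \<longleftrightarrow> is_distributor X X v \<and> v \<in> J X X \<and>
    (\<forall>\<upsilon>\<in>UF Ob. \<forall>z\<in>Ob. \<forall>c. c \<le> hom (\<upsilon>, z) \<longleftrightarrow> (\<forall>\<nu>\<in>UF Ob. klift Ob v \<nu> \<upsilon> * c \<le> hom (\<nu>, z)))"
proof -
  have "kext Ob Ob Ob hom v = hom \<longleftrightarrow> (\<forall>\<upsilon>\<in>UF Ob. \<forall>z\<in>Ob. kext Ob Ob Ob hom v (\<upsilon>, z) = hom (\<upsilon>, z))"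
    using X rel_eqI[OF kext_in_rel] unfolding is_ucat_def by metis
  also have "\<dots> \<longleftrightarrow> (\<forall>\<upsilon>\<in>UF Ob. \<forall>z\<in>Ob. \<forall>c. c \<le> hom (\<upsilon>, z) \<longleftrightarrow> c \<le> kext Ob Ob Ob hom v (\<upsilon>, z))"
    by (simp only: eq_iff_lower)
  finally show ?thesis by (simp add: is_approximating_def le_kext_iff)
qed

text \<open>Take \<upsilon> = \<open>pt x\<close>, where the lift of \<open>v\<close> is
  \<open>v\<close> itself.\<close>

lemma approximating_imp_at:
  assumes "is_approximating J X v" "x \<in> Ob"
  shows "is_approximating_at s J X v x"
  using assms UF_pt[OF assms(2)] klift_distributor_pt[OF X X]
  by (auto simp: is_approximating_iff is_approximating_at_iff[OF assms(2)])

section \<open>Continuity\<close>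

text \<open>The columns of \<open>v\<close> form the left adjoint \<open>t\<close>: the action of
  \<open>hom\<close> on \<open>v\<close> is functoriality, approximation gives the unit, and
  \<open>le\<close> is the counit.\<close>

lemma J_continuousI:
  assumes v: "is_distributor X X v"
    and at: "\<And>x. x \<in> Ob \<Longrightarrow> is_approximating_at s J X v x"
    and le: "\<And>\<nu> \<psi>. \<nu> \<in> UF Ob \<Longrightarrow> \<psi> \<in> obj JX \<Longrightarrow> v (\<nu>, S \<psi>) \<le> \<psi> \<nu>"
  shows "J_continuous s J X S"
proof -
  define t where "t x = (\<lambda>\<sigma>\<in>UF Ob. v (\<sigma>, x))" for x
  have t: "t x \<in> obj JX" if "x \<in> Ob" for x
    using J_slice[OF _ that] at[OF that] by (simp add: t_def is_approximating_at_def)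
  have "is_functor X JX t"
    unfolding is_functor_def
  proof (intro conjI ballI)
    show "t \<in> Ob \<rightarrow> obj JX" using t by auto
    fix \<upsilon> x assume \<upsilon>: "\<upsilon> \<in> UF Ob" and x: "x \<in> Ob"
    have "klift Ob v \<nu> \<upsilon> * hom (\<upsilon>, x) \<le> t x \<nu>" if "\<nu> \<in> UF Ob" for \<nu>
      using v \<upsilon> x that by (simp add: is_distributor_iff[OF X X] t_def)
    then show "hom (\<upsilon>, x) \<le> arr JX (filtermap t \<upsilon>, t x)"
      using t x by (subst le_JX_arr_filtermap_iff[where Y = Ob and \<phi> = v]) (auto simp: \<upsilon> t_def)
  qed
  \<comment> \<open>Approximation at \<open>x\<close> is tested with \<open>z = S (t x)\<close> and
    \<open>c = 1\<close>.\<close>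
  moreover have "1 \<le> hom (pt x, S (t x))" if x: "x \<in> Ob" for x
  proof -
    have "v (\<nu>, x) \<le> hom (\<nu>, S (t x))" if "\<nu> \<in> UF Ob" for \<nu>
      using le_hom_S[OF t[OF x] that] that by (simp add: t_def)
    then show ?thesis using at[OF x] S_obj[OF t[OF x]] by (simp add: is_approximating_at_iff[OF x])
  qed
  moreover have "1 \<le> arr JX (pt (t (S \<psi>)), \<psi>)" if \<psi>: "\<psi> \<in> obj JX" for \<psi>
    using le[OF _ \<psi>] by (simp add: le_JX_arr_pt_iff[OF t[OF S_obj[OF \<psi>]] \<psi>]) (simp add: t_def)
  ultimately show ?thesis
    unfolding J_continuous_def adjoint_def functor_le_def using S_functor by auto
qed

text \<open>The choice \<gamma> = \<open>w\<close> in the lifting property yields the counit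
  inequality.\<close>

lemma way_below_imp_continuous:
  assumes "is_way_below s J X S w" "is_approximating J X w"
  shows "J_continuous s J X S"
  using assms by (intro J_continuousI[of w] approximating_imp_at) (auto simp: is_way_below_iff rel_le_def)

lemma cocontinuous_imp_continuous:
  assumes v: "is_J_cocontinuous s J X S v" and at: "\<And>x. x \<in> Ob \<Longrightarrow> is_approximating_at s J X v x"
  shows "J_continuous s J X S"
proof (rule J_continuousI[OF _ at])
  show dist: "is_distributor X X v" using v by (simp add: is_J_cocontinuous_def)
  \<comment> \<open>Approximation at \<open>x\<close> with \<open>z = x\<close> and
    \<open>c = 1\<close>: reflexivity places \<open>v\<close> below \<open>hom\<close>, and \<psi>
    then absorbs the lift of \<open>hom\<close>.\<close>
  have le_hom: "v (\<sigma>, x) \<le> hom (\<sigma>, x)" if "\<sigma> \<in> UF Ob" "x \<in> Ob" for \<sigma> x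
    using at[OF that(2)] arr_refl[OF X that(2)] that by (force simp: is_approximating_at_iff)
  fix \<nu> \<psi> assume \<nu>: "\<nu> \<in> UF Ob" and \<psi>: "\<psi> \<in> obj JX"
  have "v (\<nu>, S \<psi>) = (SUP \<upsilon>\<in>UF Ob. klift Ob v \<nu> \<upsilon> * \<psi> \<upsilon>)"
    using v \<nu> \<psi> by (simp add: is_J_cocontinuous_iff)
  also have "\<dots> \<le> \<psi> \<nu>"
  proof (rule SUP_least)
    fix \<upsilon> assume \<upsilon>: "\<upsilon> \<in> UF Ob"
    have "klift Ob v \<nu> \<upsilon> * \<psi> \<upsilon> \<le> klift Ob hom \<nu> \<upsilon> * \<psi> \<upsilon>"
      using \<upsilon> le_hom by (intro quantale_mult_mono klift_mono) auto
    also have "\<dots> \<le> \<psi> \<nu>" by (rule JX_hom_mult[OF \<psi> \<nu> \<upsilon>])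
    finally show "klift Ob v \<nu> \<upsilon> * \<psi> \<upsilon> \<le> \<psi> \<nu>" .
  qed
  finally show "v (\<nu>, S \<psi>) \<le> \<psi> \<nu>" .
qed

section \<open>The distributor induced by a left adjoint of \<open>S\<close>\<close>

context
  fixes t assumes t_adjoint: "adjoint X JX t S"
begin

definition w :: "'u filter \<times> 'u \<Rightarrow> 'q" where
  "w = (\<lambda>(\<sigma>, x)\<in>UF Ob \<times> Ob. t x \<sigma>)"

lemma w_eq: "\<sigma> \<in> UF Ob \<Longrightarrow> x \<in> Ob \<Longrightarrow> w (\<sigma>, x) = t x \<sigma>"
  by (simp add: w_def)

lemma t_functor: "is_functor X JX t"
  and t_obj: "x \<in> Ob \<Longrightarrow> t x \<in> obj JX"
  using t_adjoint by (auto simp: adjoint_def is_functor_def)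

lemma unit: "x \<in> Ob \<Longrightarrow> 1 \<le> hom (pt x, S (t x))"
  using t_adjoint by (simp add: adjoint_def functor_le_def)

lemma counit:
  assumes "\<psi> \<in> obj JX" "\<nu> \<in> UF Ob"
  shows "t (S \<psi>) \<nu> \<le> \<psi> \<nu>"
proof -
  have "1 \<le> arr JX (pt (t (S \<psi>)), \<psi>)"
    using t_adjoint assms by (simp add: adjoint_def functor_le_def)
  then show ?thesis using assms by (simp add: le_JX_arr_pt_iff t_obj S_obj)
qed

lemma t_mono:
  assumes x: "x \<in> Ob" and y: "y \<in> Ob" and le: "1 \<le> hom (pt x, y)" and \<nu>: "\<nu> \<in> UF Ob"
  shows "t x \<nu> \<le> t y \<nu>"
proof -
  have "hom (pt x, y) \<le> arr JX (pt (t x), t y)"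
    using t_functor UF_pt[OF x] y by (auto simp: is_functor_def filtermap_principal dest: bspec)
  with le have "1 \<le> arr JX (pt (t x), t y)" by (rule order.trans)
  with \<nu> show ?thesis by (simp add: le_JX_arr_pt_iff t_obj x y)
qed

lemma le_JX_arr_t_iff:
  assumes "\<upsilon> \<in> UF Ob" "\<psi> \<in> obj JX"
  shows "c \<le> arr JX (filtermap t \<upsilon>, \<psi>) \<longleftrightarrow> (\<forall>\<nu>\<in>UF Ob. klift Ob w \<nu> \<upsilon> * c \<le> \<psi> \<nu>)"
  using assms t_obj by (intro le_JX_arr_filtermap_iff) (auto simp: w_eq)

text \<open>The action on the source holds because every \<open>t x\<close> is a distributor; the
  action on the target is functoriality of \<open>t\<close>.\<close>

lemma w_distributor: "is_distributor X X w"
  unfolding is_distributor_iff[OF X X]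
proof (intro conjI ballI)
  show "w \<in> rel (UF Ob) Ob" by (auto simp: w_def rel_def)
  fix \<nu> x assume \<nu>: "\<nu> \<in> UF Ob" and x: "x \<in> Ob"
  fix \<sigma> assume \<sigma>: "\<sigma> \<in> UF Ob"
  show "klift Ob hom \<nu> \<sigma> * w (\<sigma>, x) \<le> w (\<nu>, x)"
    using JX_hom_mult[OF t_obj[OF x] \<nu> \<sigma>] \<nu> \<sigma> x by (simp add: w_eq)
  have "hom (\<sigma>, x) \<le> arr JX (filtermap t \<sigma>, t x)"
    using t_functor \<sigma> x by (simp add: is_functor_def)
  then show "klift Ob w \<nu> \<sigma> * hom (\<sigma>, x) \<le> w (\<nu>, x)"
    using \<nu> x \<sigma> by (simp add: le_JX_arr_t_iff t_obj w_eq)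
qed

text \<open>The columns of \<open>w\<close> are the presheaves \<open>t x\<close>, which are in
  \<open>J\<close>, and \<open>J\<close> is determined columnwise.\<close>

lemma w_in_J: "w \<in> J X X"
proof (rule J_pointwise[OF X X w_distributor])
  fix x assume x: "x \<in> Ob"
  have "(\<lambda>\<sigma>\<in>UF Ob. w (\<sigma>, x)) = t x"
    using t_obj[OF x] x by (auto simp: JX_obj_iff w_eq PiE_def extensional_def restrict_def fun_eq_iff)
  then show "kconv Ob Ob {s} (point_upper s X x) w \<in> J X (one_cat s)"
    using t_obj[OF x] by (simp add: kconv_point_upper_to_one[OF w_distributor x] JX_obj_iff)
qed

text \<open>Since \<open>x\<close> is below the supremum of \<open>yoneda X x\<close>, monotonicity
  of \<open>t\<close> and the counit give \<open>t x\<close> below \<open>yoneda X x\<close>; hence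
  its supremum is below \<open>x\<close>.\<close>

lemma S_t_le:
  assumes x: "x \<in> Ob"
  shows "1 \<le> hom (pt (S (t x)), x)"
proof -
  have y: "yoneda X x \<in> obj JX" by (rule yoneda_obj[OF x])
  have "hom (pt x, x) \<le> hom (pt x, S (yoneda X x))"
    using le_hom_S[OF y UF_pt[OF x]] UF_pt[OF x] by (simp add: yoneda_def)
  then have *: "1 \<le> hom (pt x, S (yoneda X x))" using arr_refl[OF X x] by (rule order.trans[rotated])
  have "t x \<nu> \<le> hom (\<nu>, x)" if \<nu>: "\<nu> \<in> UF Ob" for \<nu>
  proof -
    have "t x \<nu> \<le> t (S (yoneda X x)) \<nu>" by (rule t_mono[OF x S_obj[OF y] * \<nu>])
    also have "\<dots> \<le> yoneda X x \<nu>" by (rule counit[OF y \<nu>])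
    finally show ?thesis using \<nu> by (simp add: yoneda_def)
  qed
  then show ?thesis by (simp add: le_hom_S_pt_iff t_obj x)
qed

text \<open>Unit and \<open>S_t_le\<close> make the composite of \<open>S\<close> and
  \<open>t\<close> isomorphic to the identity; \<open>functor_le_arr\<close> extends this from
  points to ultrafilters.\<close>

lemma hom_S_t:
  assumes \<upsilon>: "\<upsilon> \<in> UF Ob" and z: "z \<in> Ob"
  shows "hom (filtermap (\<lambda>x. S (t x)) \<upsilon>, z) = hom (\<upsilon>, z)"
proof (rule order.antisym)
  have St: "(\<lambda>x. S (t x)) \<in> Ob \<rightarrow> Ob" using t_obj S_obj by auto
  have id: "(\<lambda>x. x) \<in> Ob \<rightarrow> Ob" by simp
  have "functor_le X X (\<lambda>x. x) (\<lambda>x. S (t x))" "functor_le X X (\<lambda>x. S (t x)) (\<lambda>x. x)"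
    using unit S_t_le by (simp_all add: functor_le_def)
  then show "hom (filtermap (\<lambda>x. S (t x)) \<upsilon>, z) \<le> hom (\<upsilon>, z)"
    and "hom (\<upsilon>, z) \<le> hom (filtermap (\<lambda>x. S (t x)) \<upsilon>, z)"
    using functor_le_arr[OF X id St _ \<upsilon> z] functor_le_arr[OF X St id _ \<upsilon> z] by (simp_all add: filtermap_ident)
qed

text \<open>Replace \<upsilon> by its image under the composite of \<open>S\<close> and
  \<open>t\<close>, move \<open>S\<close> across its adjunction with \<open>yoneda X\<close>, and
  read the presheaf structure as residuation along \<open>w\<close>.\<close>

lemma w_approximating: "is_approximating J X w"
  unfolding is_approximating_iff
proof (intro conjI ballI allI w_distributor w_in_J)
  fix \<upsilon> z c assume \<upsilon>: "\<upsilon> \<in> UF Ob" and z: "z \<in> Ob"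
  have "hom (\<upsilon>, z) = hom (filtermap S (filtermap t \<upsilon>), z)"
    using hom_S_t[OF \<upsilon> z] by (simp add: filtermap_filtermap)
  also have "\<dots> = arr JX (filtermap t \<upsilon>, yoneda X z)"
    using t_obj by (intro hom_S z UF_filtermap[OF _ \<upsilon>]) auto
  finally show "c \<le> hom (\<upsilon>, z) \<longleftrightarrow> (\<forall>\<nu>\<in>UF Ob. klift Ob w \<nu> \<upsilon> * c \<le> hom (\<nu>, z))"
    by (simp add: le_JX_arr_t_iff[OF \<upsilon> yoneda_obj[OF z]]) (simp add: yoneda_def)
qed

text \<open>The unit gives \<open>\<gamma> (\<nu>, x) \<le> \<gamma> (\<nu>, S (t x))\<close>, and
  the bound is then applied to the presheaf \<open>t x\<close>; conversely the counit bounds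
  anything below \<open>w\<close>.\<close>

lemma w_way_below: "is_way_below s J X S w"
  unfolding is_way_below_iff rel_le_def
proof (intro conjI allI impI iffI ballI w_distributor)
  fix \<gamma> \<nu> x
  assume \<gamma>: "is_distributor X X \<gamma>" and le: "\<forall>\<nu>\<in>UF Ob. \<forall>\<psi>\<in>obj JX. \<gamma> (\<nu>, S \<psi>) \<le> \<psi> \<nu>"
    and \<nu>: "\<nu> \<in> UF Ob" and x: "x \<in> Ob"
  have Sx: "S (t x) \<in> Ob" by (intro S_obj t_obj x)
  have "\<gamma> (\<nu>, x) \<le> klift Ob \<gamma> \<nu> (pt x) * hom (pt x, S (t x))"
    using le_klift_pt[OF \<nu>] mult_one_le[OF unit[OF x]] by (rule order.trans)
  also have "\<dots> \<le> \<gamma> (\<nu>, S (t x))"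
    using \<gamma> \<nu> Sx UF_pt[OF x] by (simp add: is_distributor_iff[OF X X])
  also have "\<dots> \<le> t x \<nu>" using le \<nu> t_obj[OF x] by blast
  finally show "\<gamma> (\<nu>, x) \<le> w (\<nu>, x)" using \<nu> x by (simp add: w_eq)
next
  fix \<gamma> \<nu> \<psi>
  assume "\<forall>\<nu>\<in>UF Ob. \<forall>x\<in>Ob. \<gamma> (\<nu>, x) \<le> w (\<nu>, x)" and \<nu>: "\<nu> \<in> UF Ob" and \<psi>: "\<psi> \<in> obj JX"
  then have "\<gamma> (\<nu>, S \<psi>) \<le> t (S \<psi>) \<nu>" using S_obj[OF \<psi>] by (metis w_eq)
  also have "\<dots> \<le> \<psi> \<nu>" by (rule counit[OF \<psi> \<nu>])
  finally show "\<gamma> (\<nu>, S \<psi>) \<le> \<psi> \<nu>" .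
qed

text \<open>The presheaf \<open>\<psi>' = \<psi> \<circ> w\<close> belongs to \<open>JX\<close> and has the same supremum as \<open>\<psi>\<close>, because
  \<open>w\<close> is approximating; hence \<open>t (S \<psi>) \<le> t (S \<psi>') \<le> \<psi>'\<close>.\<close>

lemma w_cocontinuous: "is_J_cocontinuous s J X S w"
  unfolding is_J_cocontinuous_iff
proof (intro conjI ballI w_distributor)
  fix \<nu> \<psi> assume \<nu>: "\<nu> \<in> UF Ob" and \<psi>: "\<psi> \<in> obj JX"
  define \<psi>' where "\<psi>' = (\<lambda>\<nu>\<in>UF Ob. SUP \<upsilon>\<in>UF Ob. klift Ob w \<nu> \<upsilon> * \<psi> \<upsilon>)"
  have \<psi>': "\<psi>' \<nu> = (SUP \<upsilon>\<in>UF Ob. klift Ob w \<nu> \<upsilon> * \<psi> \<upsilon>)" if "\<nu> \<in> UF Ob" for \<nu>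
    using that by (simp add: \<psi>'_def)
  \<comment> \<open>Exhibits \<psi>' as a convolution of members of \<open>J\<close>.\<close>
  have "to_one s X \<psi>' = kconv Ob Ob {s} (to_one s X \<psi>) w"
  proof (rule rel_eqI[OF _ kconv_in_rel])
    show "to_one s X \<psi>' \<in> rel (UF Ob) {s}" by (auto simp: to_one_def rel_def)
  qed (simp add: kconv_eq to_one_def \<psi>' cong: SUP_cong)
  also have "\<dots> \<in> J X (one_cat s)"
    using J_kconv[OF X X is_ucat_one_cat w_in_J] \<psi> by (simp add: JX_obj_iff)
  finally have \<psi>'_obj: "\<psi>' \<in> obj JX" by (auto simp: JX_obj_iff \<psi>'_def)
  have S\<psi>': "S \<psi>' \<in> Ob" by (rule S_obj[OF \<psi>'_obj])
  \<comment> \<open>Approximation reduces this to bounds on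
    \<open>klift Ob w \<nu> \<upsilon> * \<psi> \<upsilon>\<close>, which are terms of the supremum
    defining \<psi>'.\<close>
  have "\<psi> \<upsilon> \<le> hom (\<upsilon>, S \<psi>')" if \<upsilon>: "\<upsilon> \<in> UF Ob" for \<upsilon>
  proof -
    have "klift Ob w \<nu> \<upsilon> * \<psi> \<upsilon> \<le> hom (\<nu>, S \<psi>')" if \<nu>: "\<nu> \<in> UF Ob" for \<nu>
    proof -
      have "klift Ob w \<nu> \<upsilon> * \<psi> \<upsilon> \<le> \<psi>' \<nu>" unfolding \<psi>'[OF \<nu>] using \<upsilon> by (rule SUP_upper)
      also have "\<dots> \<le> hom (\<nu>, S \<psi>')" by (rule le_hom_S[OF \<psi>'_obj \<nu>])
      finally show ?thesis .
    qed
    with w_approximating \<upsilon> S\<psi>' show ?thesis unfolding is_approximating_iff by blast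
  qed
  then have "1 \<le> hom (pt (S \<psi>), S \<psi>')" by (simp add: le_hom_S_pt_iff[OF \<psi> S\<psi>'])
  then have "t (S \<psi>) \<nu> \<le> t (S \<psi>') \<nu>" using \<nu> by (intro t_mono S_obj \<psi> S\<psi>')
  also have "\<dots> \<le> \<psi>' \<nu>" by (rule counit[OF \<psi>'_obj \<nu>])
  finally have "w (\<nu>, S \<psi>) \<le> \<psi>' \<nu>" using \<nu> S_obj[OF \<psi>] by (simp add: w_eq)
  \<comment> \<open>Here \<psi> is below the column of \<open>hom\<close> at
    \<open>S \<psi>\<close>, and \<open>w\<close> absorbs \<open>hom\<close>.\<close>
  moreover have "\<psi>' \<nu> \<le> w (\<nu>, S \<psi>)"
    unfolding \<psi>'[OF \<nu>]
  proof (rule SUP_least)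
    fix \<upsilon> assume \<upsilon>: "\<upsilon> \<in> UF Ob"
    have "klift Ob w \<nu> \<upsilon> * \<psi> \<upsilon> \<le> klift Ob w \<nu> \<upsilon> * hom (\<upsilon>, S \<psi>)"
      by (intro quantale_mult_mono order.refl le_hom_S[OF \<psi> \<upsilon>])
    also have "\<dots> \<le> w (\<nu>, S \<psi>)"
      using w_distributor \<nu> \<upsilon> S_obj[OF \<psi>] by (simp add: is_distributor_iff[OF X X])
    finally show "klift Ob w \<nu> \<upsilon> * \<psi> \<upsilon> \<le> w (\<nu>, S \<psi>)" .
  qed
  ultimately show "w (\<nu>, S \<psi>) = (SUP \<upsilon>\<in>UF Ob. klift Ob w \<nu> \<upsilon> * \<psi> \<upsilon>)"
    using \<psi>'[OF \<nu>] by (simp add: order.antisym)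
qed

end

end

theorem theorem5p21:
  fixes s :: 'u
    and J :: "('u, 'q::quantale) dist_class"
    and X :: "('u, 'q) ucat"
    and S :: "('u filter \<Rightarrow> 'q) \<Rightarrow> 'u"
  assumes "strict_topological_theory TYPE('q) TYPE('u)"
    and "is_dist_class s J"
    and "is_ucat X"
    and "J_cocomplete s J X S"
  shows "(J_continuous s J X S
            \<longleftrightarrow> (\<exists>w. is_way_below s J X S w \<and> is_approximating J X w))
       \<and> (J_continuous s J X S
            \<longleftrightarrow> (\<exists>v. is_J_cocontinuous s J X S v \<and> is_approximating J X v))
       \<and> (J_continuous s J X S
            \<longleftrightarrow> (\<exists>v. is_J_cocontinuous s J X S v \<and> (\<forall>x\<in>obj X. is_approximating_at s J X v x)))"
proof -
  interpret J_cocomplete_cat s J X S using assms(2-4) by unfold_locales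
  \<comment> \<open>A single \<open>w\<close> witnesses all three existence statements.\<close>
  have "J_continuous s J X S \<Longrightarrow> \<exists>w. is_way_below s J X S w \<and> is_J_cocontinuous s J X S w \<and>
      is_approximating J X w"
    unfolding J_continuous_def using w_way_below w_cocontinuous w_approximating by blast
  then show ?thesis
    using way_below_imp_continuous cocontinuous_imp_continuous approximating_imp_at by meson
qed

end
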